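(* Let $n \ge 2$ and let $u \in F_n$ be an element whose length cannot be decreased by any automorphism of $F_n$. Let $N$ be the number of automorphic images of $u$ that have the same length as $u$, i.e. the number of $w \in F_n$ with $|w| = |u|$ and $w = \phi(u)$ for some $\phi \in \mathrm{Aut}(F_n)$. Then, given an element $v \in F_n$ of length $|u|$, one can decide in linear time with respect to $N$ (that is, in at most $C \cdot N$ steps, where the constant $C$ depends only on $n$) whether or not $v$ is an automorphic image of $u$, i.e. whether $v = \phi(u)$ for some $\phi \in \mathrm{Aut}(F_n)$.
   Context: $F_n$ is the free group of rank $n$ with fixed free basis $X$, and $|u|$ denotes reduced word length. An elementary Whitehead automorphism is either (i) an automorphism permuting the set $X^{\pm1}$, or (ii) an automorphism for which there is a fixed letter $a \in X^{\pm 1}$ with $a \mapsto a$ and every basis element $x \in X$ with $x \neq a^{\pm1}$ mapped to one of $x,\ xa,\ a^{-1}x,\ a^{-1}xa$; the number of these is finite and depends only on $n$. Time is counted in steps on words treated as vertices of a graph: one step is applying one elementary Whitehead automorphism to a word (together with checking whether the result has length $|u|$ and whether it has already been obtained), moving from one already obtained word to another one adjacent to it, or comparing an obtained word with $v$. *)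

theory Defs
  imports "HOL-Algebra.Bij"
begin

section \<open>The free group on \<open>x\<^sub>0, \<dots>, x\<^sub>n\<^sub>-\<^sub>1\<close>\<close>

text \<open>
  The letter \<open>(i, True)\<close> is the basis element \<open>x\<^sub>i\<close>, and \<open>(i, False)\<close> is its inverse.  An element of
  the free group is a reduced word, so its word length is \<^const>\<open>length\<close>.
\<close>

type_synonym letter = "nat \<times> bool"
type_synonym word = "letter list"

definition letter_inv :: "letter \<Rightarrow> letter" where
  "letter_inv x = (fst x, \<not> snd x)"

definition letters :: "nat \<Rightarrow> letter set" where
  "letters n = {..<n} \<times> UNIV"

definition reduced :: "word \<Rightarrow> bool" where
  "reduced w \<longleftrightarrow> successively (\<lambda>x y. y \<noteq> letter_inv x) w"

fun cons_reduce :: "letter \<Rightarrow> word \<Rightarrow> word" where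
  "cons_reduce x [] = [x]"
| "cons_reduce x (y # w) = (if y = letter_inv x then w else x # y # w)"

definition free_group :: "nat \<Rightarrow> word monoid" where
  "free_group n =
     \<lparr>carrier = {w. set w \<subseteq> letters n \<and> reduced w},
      mult = (\<lambda>u v. foldr cons_reduce u v),
      one = []\<rparr>"

lemma letter_inv_letter_inv [simp]: "letter_inv (letter_inv x) = x"
  by (simp add: letter_inv_def)

lemma letter_inv_neq [simp]: "letter_inv x \<noteq> x" "x \<noteq> letter_inv x"
  by (auto simp: letter_inv_def prod_eq_iff)

lemma letter_inv_in_letters [simp]: "letter_inv x \<in> letters n \<longleftrightarrow> x \<in> letters n"
  by (cases x) (auto simp: letter_inv_def letters_def)

lemma reduced_ConsD: "reduced (x # w) \<Longrightarrow> reduced w"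
  by (cases w) (auto simp: reduced_def)

lemma reduced_cons_reduce: "reduced w \<Longrightarrow> reduced (cons_reduce x w)"
  by (cases w) (auto simp: reduced_def successively_Cons)

lemma set_cons_reduce: "set (cons_reduce x w) \<subseteq> insert x (set w)"
  by (cases w) auto

lemma cons_reduce_eq_Cons: "reduced (x # w) \<Longrightarrow> cons_reduce x w = x # w"
  by (cases w) (auto simp: reduced_def)

lemma cons_reduce_inverse:
  assumes "reduced w"
  shows "cons_reduce x (cons_reduce (letter_inv x) w) = w"
proof (cases w)
  case (Cons y ys)
  show ?thesis
  proof (cases "y = x")
    case True
    then show ?thesis using assms Cons by (simp add: cons_reduce_eq_Cons)
  qed (use Cons in auto)
qed auto

lemma reduced_foldr_cons_reduce: "reduced v \<Longrightarrow> reduced (foldr cons_reduce u v)"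
  by (induction u) (auto intro: reduced_cons_reduce)

lemma set_foldr_cons_reduce: "set (foldr cons_reduce u v) \<subseteq> set u \<union> set v"
proof (induction u)
  case (Cons x u)
  then show ?case using set_cons_reduce[of x "foldr cons_reduce u v"] by auto
qed simp

lemma foldr_cons_reduce_cons_reduce:
  assumes "reduced w"
  shows "foldr cons_reduce (cons_reduce x z) w = cons_reduce x (foldr cons_reduce z w)"
proof (cases z)
  case (Cons y ys)
  show ?thesis
  proof (cases "y = letter_inv x")
    case True
    then show ?thesis
      using Cons assms by (simp add: cons_reduce_inverse reduced_foldr_cons_reduce)
  qed (use Cons in auto)
qed auto

lemma foldr_cons_reduce_assoc:
  assumes "reduced w"
  shows "foldr cons_reduce (foldr cons_reduce u v) w = foldr cons_reduce u (foldr cons_reduce v w)"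
  by (induction u) (auto simp: foldr_cons_reduce_cons_reduce assms)

lemma foldr_cons_reduce_inverse:
  "reduced w \<Longrightarrow> foldr cons_reduce (rev (map letter_inv u)) (foldr cons_reduce u w) = w"
proof (induction u)
  case (Cons x u)
  then show ?case
    using cons_reduce_inverse[of "foldr cons_reduce u w" "letter_inv x"]
    by (simp add: reduced_foldr_cons_reduce)
qed simp

lemma reduced_Nil [simp]: "reduced []"
  by (simp add: reduced_def)

lemma foldr_cons_reduce_Nil: "reduced u \<Longrightarrow> foldr cons_reduce u [] = u"
proof (induction u)
  case (Cons x u)
  then show ?case using reduced_ConsD[of x u] by (simp add: cons_reduce_eq_Cons)
qed simp

lemma group_free_group: "group (free_group n)"
proof (rule groupI)
  fix u assume u: "u \<in> carrier (free_group n)"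
  define v where "v = foldr cons_reduce (rev (map letter_inv u)) []"
  have "set v \<subseteq> letters n"
    using u set_foldr_cons_reduce[of "rev (map letter_inv u)" "[]"]
    by (fastforce simp: v_def free_group_def)
  moreover have "foldr cons_reduce v u = []"
    using u foldr_cons_reduce_assoc[of u "rev (map letter_inv u)" "[]"]
      foldr_cons_reduce_inverse[of "[]" u]
    by (simp add: v_def free_group_def foldr_cons_reduce_Nil)
  ultimately show "\<exists>v\<in>carrier (free_group n). v \<otimes>\<^bsub>free_group n\<^esub> u = \<one>\<^bsub>free_group n\<^esub>"
    by (intro bexI[of _ v]) (auto simp: free_group_def v_def reduced_foldr_cons_reduce)
next
  fix u v assume "u \<in> carrier (free_group n)" "v \<in> carrier (free_group n)"
  then show "u \<otimes>\<^bsub>free_group n\<^esub> v \<in> carrier (free_group n)"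
    using set_foldr_cons_reduce[of u v]
    by (auto simp: free_group_def reduced_foldr_cons_reduce)
qed (auto simp: free_group_def foldr_cons_reduce_assoc)


section \<open>Automorphisms\<close>

definition basis :: "nat \<Rightarrow> word set" where
  "basis n = {[(i, True)] | i. i < n}"

definition signed_basis :: "nat \<Rightarrow> word set" where
  "signed_basis n = {[x] | x. x \<in> letters n}"

definition permutation_automorphism :: "nat \<Rightarrow> (word \<Rightarrow> word) \<Rightarrow> bool" where
  "permutation_automorphism n \<phi> \<longleftrightarrow>
     \<phi> \<in> auto (free_group n) \<and> bij_betw \<phi> (signed_basis n) (signed_basis n)"

definition multiplier_automorphism :: "nat \<Rightarrow> (word \<Rightarrow> word) \<Rightarrow> bool" where
  "multiplier_automorphism n \<phi> \<longleftrightarrow>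
     \<phi> \<in> auto (free_group n) \<and>
     (\<exists>a\<in>signed_basis n.
        \<phi> a = a \<and>
        (\<forall>x\<in>basis n. x \<noteq> a \<and> x \<noteq> inv\<^bsub>free_group n\<^esub> a \<longrightarrow>
           \<phi> x \<in> {x,
                  x \<otimes>\<^bsub>free_group n\<^esub> a,
                  inv\<^bsub>free_group n\<^esub> a \<otimes>\<^bsub>free_group n\<^esub> x,
                  inv\<^bsub>free_group n\<^esub> a \<otimes>\<^bsub>free_group n\<^esub> x \<otimes>\<^bsub>free_group n\<^esub> a}))"

definition elementary_whitehead :: "nat \<Rightarrow> (word \<Rightarrow> word) set" where
  "elementary_whitehead n =
     {\<tau>. permutation_automorphism n \<tau> \<or> multiplier_automorphism n \<tau>}"

definition automorphic_image :: "nat \<Rightarrow> word \<Rightarrow> word \<Rightarrow> bool" where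
  "automorphic_image n u v \<longleftrightarrow> (\<exists>\<phi>\<in>auto (free_group n). v = \<phi> u)"

definition length_minimal :: "nat \<Rightarrow> word \<Rightarrow> bool" where
  "length_minimal n u \<longleftrightarrow> (\<forall>\<phi>\<in>auto (free_group n). length u \<le> length (\<phi> u))"

definition same_length_images :: "nat \<Rightarrow> word \<Rightarrow> word set" where
  "same_length_images n u =
     {w \<in> carrier (free_group n). length w = length u \<and> automorphic_image n u w}"


section \<open>Algorithms on words treated as vertices of a graph\<close>

text \<open>
  An algorithm is a finite-state machine that walks on the words obtained so far.  Every transition
  except halting is one counted step, and it has access to the words only through the outcome of
  that step.

  \<^item> \<open>Apply \<tau> q\<^sub>1 q\<^sub>2 q\<^sub>3\<close> computes the image of the current word under the elementary Whitehead
    automorphism \<open>\<tau>\<close>.  The next state is \<open>q\<^sub>1\<close> if the image has the wrong length, \<open>q\<^sub>2\<close> if it has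
    already been obtained, and \<open>q\<^sub>3\<close> if it is new, in which case it becomes an obtained word.  The
    current word does not change.
  \<^item> \<open>Move \<tau> q\<close> walks along the edge labelled \<open>\<tau>\<close> to an adjacent word, which must have been
    obtained already; otherwise the machine is stuck and never halts.
  \<^item> \<open>Compare q\<^sub>1 q\<^sub>2\<close> compares the current word with the input \<open>v\<close>.

  For bookkeeping, such as remembering how to return from a word, each obtained word carries a mark
  from a finite alphabet.  In state \<open>q\<close> at a word with mark \<open>m\<close>, the machine \<open>P\<close> overwrites that mark
  by \<^term>\<open>fst (P q m)\<close> and performs \<^term>\<open>snd (P q m)\<close>.  New words get the mark \<open>0\<close>.  So only
  a bounded amount of work accompanies each counted step.
\<close>

datatype action =
    Apply "word \<Rightarrow> word" nat nat nat
  | Move "word \<Rightarrow> word" nat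
  | Compare nat nat
  | Halt bool

type_synonym machine = "nat \<Rightarrow> nat \<Rightarrow> nat \<times> action"

fun valid_action :: "nat \<Rightarrow> nat \<Rightarrow> action \<Rightarrow> bool" where
  "valid_action n k (Apply \<tau> q1 q2 q3) \<longleftrightarrow>
     \<tau> \<in> elementary_whitehead n \<and> q1 < k \<and> q2 < k \<and> q3 < k"
| "valid_action n k (Move \<tau> q) \<longleftrightarrow> \<tau> \<in> elementary_whitehead n \<and> q < k"
| "valid_action n k (Compare q1 q2) \<longleftrightarrow> q1 < k \<and> q2 < k"
| "valid_action n k (Halt b) \<longleftrightarrow> True"

text \<open>States and marks are both taken from \<open>{0, \<dots>, k - 1}\<close>, so a machine is a finite table.\<close>

definition word_machine :: "nat \<Rightarrow> machine \<Rightarrow> bool" where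
  "word_machine n P \<longleftrightarrow>
     (\<exists>k>0. \<forall>q<k. \<forall>m<k. fst (P q m) < k \<and> valid_action n k (snd (P q m)))"

text \<open>
  A configuration consists of the state, the current word and the marks; the domain of the marks is
  the set of obtained words.
\<close>

type_synonym config = "nat \<times> word \<times> (word \<rightharpoonup> nat)"

datatype outcome = Continue config | Answer bool | Stuck

fun perform :: "nat \<Rightarrow> word \<Rightarrow> action \<Rightarrow> word \<Rightarrow> (word \<rightharpoonup> nat) \<Rightarrow> outcome" where
  "perform l v (Apply \<tau> q1 q2 q3) w M =
     (if length (\<tau> w) \<noteq> l then Continue (q1, w, M)
      else if \<tau> w \<in> dom M then Continue (q2, w, M)
      else Continue (q3, w, M(\<tau> w \<mapsto> 0)))"
| "perform l v (Move \<tau> q) w M = (if \<tau> w \<in> dom M then Continue (q, \<tau> w, M) else Stuck)"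
| "perform l v (Compare q1 q2) w M = Continue (if w = v then q1 else q2, w, M)"
| "perform l v (Halt b) w M = Answer b"

fun transition :: "machine \<Rightarrow> nat \<Rightarrow> word \<Rightarrow> config \<Rightarrow> outcome" where
  "transition P l v (q, w, M) =
     (case P q (the (M w)) of (m, act) \<Rightarrow> perform l v act w (M(w \<mapsto> m)))"

inductive halts_from :: "machine \<Rightarrow> nat \<Rightarrow> word \<Rightarrow> config \<Rightarrow> nat \<Rightarrow> bool \<Rightarrow> bool"
  for P l v where
  answer: "transition P l v c = Answer b \<Longrightarrow> halts_from P l v c 0 b"
| continue: "transition P l v c = Continue c' \<Longrightarrow> halts_from P l v c' t b
    \<Longrightarrow> halts_from P l v c (Suc t) b"

text \<open>On input \<open>u\<close> and \<open>v\<close> the machine \<open>P\<close> gives the answer \<open>b\<close> after exactly \<open>t\<close> steps.\<close>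

definition answers_in :: "machine \<Rightarrow> word \<Rightarrow> word \<Rightarrow> nat \<Rightarrow> bool \<Rightarrow> bool" where
  "answers_in P u v t b \<longleftrightarrow> halts_from P (length u) v (0, u, [u \<mapsto> 0]) t b"

end

theory Submission
  imports Defs "HOL-Combinatorics.Permutations"
begin

text \<open>
  The proof is Higgins and Lyndon's peak reduction, for words instead of cyclic words.  A word
  \<open>x\<^sub>1 \<dots> x\<^sub>k\<close> is treated as the cyclic word \<open>* x\<^sub>1 \<dots> x\<^sub>k\<close> with a marker \<open>*\<close> that
  equals its own inverse.  For a set \<open>A\<close> of letters and possibly \<open>*\<close> with \<open>a \<in> A\<close>, \<open>a\<^sup>-\<^sup>1 \<notin> A\<close>, the
  Whitehead automorphism \<open>(A, a)\<close> changes the length by the number of adjacent pairs \<open>x y\<close> for which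
  \<open>A\<close> separates \<open>x\<close> from \<open>y\<^sup>-\<^sup>1\<close>, minus the number of occurrences of \<open>a\<close> and \<open>a\<^sup>-\<^sup>1\<close>.  The first
  number is a submodular function of \<open>A\<close>.  Hence if two automorphisms \<open>(A, a)\<close>, \<open>(B, b)\<close> do not lengthen a word and
  one of them shortens it, then some intersection of \<open>A\<close> or its complement with \<open>B\<close> or its
  complement carries a shortening automorphism too, which reduces the problem to disjoint sets, where
  explicit relations between the automorphisms go around the peak.  Since Nielsen's reduction shows
  that Whitehead automorphisms generate the automorphism group, two automorphic words of minimal
  length are joined by elementary Whitehead automorphisms through words of that same length, and a
  depth-first search finds them all in linear time.
\<close>

section \<open>Free reduction and homomorphisms\<close>

definition red :: "word \<Rightarrow> word" where
  "red w = foldr cons_reduce w []"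

definition winv :: "word \<Rightarrow> word" where
  "winv w = rev (map letter_inv w)"

definition respects_inv :: "(letter \<Rightarrow> word) \<Rightarrow> bool" where
  "respects_inv f \<longleftrightarrow> (\<forall>x. f (letter_inv x) = winv (f x))"

definition lift_hom :: "(letter \<Rightarrow> word) \<Rightarrow> word \<Rightarrow> word" where
  "lift_hom f w = red (concat (map f w))"

lemma letter_inv_eq_iff [simp]: "letter_inv x = letter_inv y \<longleftrightarrow> x = y"
  by (metis letter_inv_letter_inv)

lemma reduced_red [simp]: "reduced (red w)"
  by (simp add: red_def reduced_foldr_cons_reduce)

lemma red_reduced: "reduced w \<Longrightarrow> red w = w"
  by (simp add: red_def foldr_cons_reduce_Nil)

lemma red_Nil [simp]: "red [] = []"
  by (simp add: red_def)

lemma red_Cons: "red (x # w) = cons_reduce x (red w)"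
  by (simp add: red_def)

lemma red_append: "red (u @ v) = foldr cons_reduce u (red v)"
  by (simp add: red_def)

lemma foldr_cons_reduce_eq_red: "reduced v \<Longrightarrow> foldr cons_reduce u v = red (u @ v)"
  by (simp add: red_append red_reduced)

lemma red_append_red [simp]: "red (u @ red v) = red (u @ v)"
  by (simp add: red_append red_reduced)

lemma red_red_append [simp]: "red (red u @ v) = red (u @ v)"
  unfolding red_append by (simp add: red_def[of u] foldr_cons_reduce_assoc)

lemma red_red [simp]: "red (red u) = red u"
  by (simp add: red_reduced)

lemma red_append_cong: "red u = red u' \<Longrightarrow> red v = red v' \<Longrightarrow> red (u @ v) = red (u' @ v')"
  by (metis red_append_red red_red_append)

lemma set_red: "set (red w) \<subseteq> set w"
  using set_foldr_cons_reduce[of w "[]"] by (simp add: red_def)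

lemma winv_append [simp]: "winv (u @ v) = winv v @ winv u"
  by (simp add: winv_def)

lemma winv_Nil [simp]: "winv [] = []"
  by (simp add: winv_def)

lemma winv_Cons: "winv (x # u) = winv u @ [letter_inv x]"
  by (simp add: winv_def)

lemma winv_winv [simp]: "winv (winv u) = u"
  by (simp add: winv_def rev_map comp_def)

lemma length_winv [simp]: "length (winv u) = length u"
  by (simp add: winv_def)

lemma winv_eq_Nil [simp]: "winv u = [] \<longleftrightarrow> u = []"
  by (simp add: winv_def)

lemma winv_eq_iff [simp]: "winv u = winv v \<longleftrightarrow> u = v"
  by (metis winv_winv)

lemma set_winv [simp]: "set (winv u) = letter_inv ` set u"
  by (simp add: winv_def)

lemma red_winv_append [simp]: "red (winv u @ u @ v) = red v"
  using foldr_cons_reduce_inverse[of "red v" u]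
  by (simp add: red_append winv_def red_reduced)

lemma red_append_winv [simp]: "red (u @ winv u @ v) = red v"
  using red_winv_append[of "winv u" v] by simp

lemma red_winv_append' [simp]: "red (winv u @ u) = []"
  using red_winv_append[of u "[]"] by simp

lemma red_append_winv' [simp]: "red (u @ winv u) = []"
  using red_append_winv[of u "[]"] by simp

lemma reduced_append_iff:
  "reduced (u @ v) \<longleftrightarrow> reduced u \<and> reduced v \<and> (u = [] \<or> v = [] \<or> hd v \<noteq> letter_inv (last u))"
  by (auto simp: reduced_def successively_append_iff)

lemma reduced_Cons_iff: "reduced (x # w) \<longleftrightarrow> reduced w \<and> (w = [] \<or> hd w \<noteq> letter_inv x)"
  using reduced_append_iff[of "[x]" w] by (simp add: reduced_def)

lemma reduced_single [simp]: "reduced [x]"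
  by (simp add: reduced_def)

lemma reduced_winv [simp]: "reduced (winv u) \<longleftrightarrow> reduced u"
proof -
  have "reduced (winv u)" if "reduced u" for u
    using that
  proof (induction u)
    case (Cons x u)
    then show ?case
      by (cases u) (auto simp: winv_Cons reduced_append_iff reduced_Cons_iff)
  qed simp
  from this[of u] this[of "winv u"] show ?thesis by auto
qed

text \<open>Inverses are unique: \<open>u @ winv (red u)\<close> reduces to the empty word;
  appending it to \<open>winv u\<close> and cancelling \<open>winv u @ u\<close> instead leaves
  \<open>winv (red u)\<close>.\<close>

lemma red_winv: "red (winv u) = winv (red u)"
proof -
  have "red (winv u) = red (winv u @ red (u @ winv (red u)))"
    by (metis append_Nil2 red_append_red red_append_winv' red_red_append red_Nil)
  also have "\<dots> = red (winv (red u))"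
    by simp
  finally show ?thesis by (simp add: red_reduced)
qed

lemma respects_invD: "respects_inv f \<Longrightarrow> f (letter_inv x) = winv (f x)"
  unfolding respects_inv_def by blast

lemma lift_hom_append: "lift_hom f (u @ v) = red (lift_hom f u @ lift_hom f v)"
  by (simp add: lift_hom_def)

text \<open>A cancelled pair of letters is sent to a word next to its formal inverse, which cancels
  as well.\<close>

lemma lift_hom_red [simp]:
  assumes "respects_inv f"
  shows "lift_hom f (red w) = lift_hom f w"
proof (induction w)
  case (Cons x w)
  have "lift_hom f (cons_reduce x r) = red (f x @ concat (map f r))" for r
  proof (cases r)
    case (Cons y ys)
    then show ?thesis
      using assms by (auto simp: lift_hom_def respects_invD)
  qed (simp add: lift_hom_def)
  then have "lift_hom f (red (x # w)) = red (f x @ lift_hom f (red w))"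
    by (simp add: red_Cons lift_hom_def)
  also have "\<dots> = lift_hom f (x # w)"
    using Cons by (simp add: lift_hom_def red_append)
  finally show ?case .
qed simp

lemma lift_hom_lift_hom:
  assumes "respects_inv f"
  shows "lift_hom f (lift_hom g w) = lift_hom (\<lambda>x. concat (map f (g x))) w"
proof -
  have "concat (map f (concat (map g w))) = concat (map (\<lambda>x. concat (map f (g x))) w)"
    by (induction w) auto
  then show ?thesis
    using lift_hom_red[OF assms, of "concat (map g w)"] by (simp add: lift_hom_def)
qed

lemma lift_hom_cong:
  assumes "\<And>x. x \<in> set w \<Longrightarrow> red (f x) = red (g x)"
  shows "lift_hom f w = lift_hom g w"
  using assms by (induction w) (auto simp: lift_hom_def intro: red_append_cong)

text \<open>Turns a relation between automorphisms into a case distinction on the position of one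
  letter; the relations for disjoint sets are checked this way.\<close>

lemma lift_hom_comp_eqI:
  assumes "respects_inv f" "respects_inv f'"
    and "\<And>x. x \<in> set w \<Longrightarrow> red (concat (map f (g x))) = red (concat (map f' (g' x)))"
  shows "lift_hom f (lift_hom g w) = lift_hom f' (lift_hom g' w)"
  using assms by (auto simp: lift_hom_lift_hom intro: lift_hom_cong)

lemma reduced_lift_hom [simp]: "reduced (lift_hom f w)"
  by (simp add: lift_hom_def)

lemma lift_hom_singletons: "lift_hom (\<lambda>x. [x]) w = red w"
proof -
  have "concat (map (\<lambda>x. [x]) w) = w" by (induction w) auto
  then show ?thesis by (simp add: lift_hom_def)
qed

lemma carrier_free_group: "carrier (free_group n) = {w. set w \<subseteq> letters n \<and> reduced w}"
  by (simp add: free_group_def)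

lemma lift_hom_in_carrier:
  assumes "set w \<subseteq> letters n" "\<And>x. x \<in> letters n \<Longrightarrow> set (f x) \<subseteq> letters n"
  shows "lift_hom f w \<in> carrier (free_group n)"
  using assms set_red[of "concat (map f w)"] unfolding lift_hom_def carrier_free_group by fastforce

section \<open>Whitehead automorphisms and their effect on length\<close>

text \<open>
  The marker is \<^term>\<open>None\<close>, and \<open>transit A a p q\<close> is the power of \<open>a\<close> with exponent
  \<open>[p \<in> A] - [q \<in> A]\<close>.  If the marker is in \<open>A\<close>, then \<open>whitehead A a\<close> is the usual Whitehead
  automorphism followed by conjugation with \<open>a\<close>; thus a set and its complement give the same map.
\<close>

definition transit :: "letter option set \<Rightarrow> letter \<Rightarrow> letter option \<Rightarrow> letter option \<Rightarrow> word" where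
  "transit A a p q =
     (if p \<in> A \<and> q \<notin> A then [a] else if p \<notin> A \<and> q \<in> A then [letter_inv a] else [])"

definition whitehead_map :: "letter option set \<Rightarrow> letter \<Rightarrow> letter \<Rightarrow> word" where
  "whitehead_map A a x =
     (if x = a \<or> x = letter_inv a then [x]
      else transit A a None (Some (letter_inv x)) @ [x] @ transit A a (Some x) None)"

abbreviation whitehead :: "letter option set \<Rightarrow> letter \<Rightarrow> word \<Rightarrow> word" where
  "whitehead A a \<equiv> lift_hom (whitehead_map A a)"

definition separates :: "letter option set \<Rightarrow> letter \<Rightarrow> bool" where
  "separates A a \<longleftrightarrow> Some a \<in> A \<and> Some (letter_inv a) \<notin> A"

text \<open>
  \<open>cap A None w\<close> counts the edges of the Whitehead graph of the marked word that join \<open>A\<close> to its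
  complement.
\<close>

fun cap :: "letter option set \<Rightarrow> letter option \<Rightarrow> word \<Rightarrow> nat" where
  "cap A p [] = of_bool ((p \<in> A) \<noteq> (None \<in> A))"
| "cap A p (x # w) = of_bool ((p \<in> A) \<noteq> (Some (letter_inv x) \<in> A)) + cap A (Some x) w"

definition occ :: "letter \<Rightarrow> word \<Rightarrow> nat" where
  "occ a w = length (filter (\<lambda>x. x = a \<or> x = letter_inv a) w)"

definition core :: "letter \<Rightarrow> letter \<Rightarrow> word" where
  "core a x = (if x = a \<or> x = letter_inv a then [] else [x])"

text \<open>
  The image of a reduced word in reduced form.  The letters \<open>a\<close> and \<open>a\<^sup>-\<^sup>1\<close> are left out because the
  transitions at their two sides produce them: \<open>A\<close> contains \<open>a\<close> but not \<open>a\<^sup>-\<^sup>1\<close>.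
\<close>

fun whitehead_word :: "letter option set \<Rightarrow> letter \<Rightarrow> letter option \<Rightarrow> word \<Rightarrow> word" where
  "whitehead_word A a p [] = transit A a p None"
| "whitehead_word A a p (x # w) =
     transit A a p (Some (letter_inv x)) @ core a x @ whitehead_word A a (Some x) w"

lemma letter_inv_swap: "letter_inv x = y \<longleftrightarrow> x = letter_inv y"
  by auto

lemma winv_transit: "winv (transit A a p q) = transit A a q p"
  by (auto simp: transit_def winv_def)

lemma red_Cons_Cons_inv [simp]:
  "red (x # letter_inv x # w) = red w" "red (letter_inv x # x # w) = red w"
  using red_append_winv[of "[x]" w] red_winv_append[of "[x]" w] by (simp_all add: winv_def)

text \<open>The exponents \<open>[p \<in> A] - [q \<in> A]\<close> telescope.\<close>

lemma red_transit_append [simp]: "red (transit A a p q @ transit A a q r @ w) = red (transit A a p r @ w)"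
  by (auto simp: transit_def)

lemma transit_Compl: "transit (- A) (letter_inv a) p q = transit A a p q"
  by (auto simp: transit_def)

lemma whitehead_map_Compl: "whitehead_map (- A) (letter_inv a) = whitehead_map A a"
  by (auto simp: whitehead_map_def transit_Compl fun_eq_iff)

lemma separates_Compl: "separates A a \<Longrightarrow> separates (- A) (letter_inv a)"
  by (simp add: separates_def)

lemma respects_inv_whitehead_map [simp]: "respects_inv (whitehead_map A a)"
  unfolding respects_inv_def
  by (auto simp: whitehead_map_def winv_transit winv_Cons letter_inv_swap)

lemma cap_Compl [simp]: "cap (- A) p w = cap A p w"
  by (induction w arbitrary: p) auto

lemma occ_letter_inv [simp]: "occ (letter_inv a) w = occ a w"
  by (simp add: occ_def disj_commute)

text \<open>True edge by edge: an edge cut by both the intersection and the union is cut by both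
  \<open>A\<close> and \<open>B\<close>, and an edge cut by one of them is cut by \<open>A\<close>
  or \<open>B\<close>.\<close>

lemma cap_submodular: "cap (A \<inter> B) p w + cap (A \<union> B) p w \<le> cap A p w + cap B p w"
proof (induction w arbitrary: p)
  case (Cons x w)
  show ?case using Cons[of "Some x"] by (auto simp: of_bool_def)
qed (auto simp: of_bool_def)

text \<open>Routing every transition through the marker regroups the word into the images of the
  single letters.\<close>

lemma red_whitehead_word:
  assumes "separates A a"
  shows "red (whitehead_word A a p w) = red (transit A a p None @ concat (map (whitehead_map A a) w))"
proof (induction w arbitrary: p)
  case (Cons x w)
  let ?c = "concat (map (whitehead_map A a) w)"
  have "red (whitehead_word A a p (x # w)) =
      red (transit A a p (Some (letter_inv x)) @ core a x @ red (whitehead_word A a (Some x) w))"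
    unfolding whitehead_word.simps by (metis append_assoc red_append_red)
  also have "\<dots> = red (transit A a p (Some (letter_inv x)) @ core a x @ transit A a (Some x) None @ ?c)"
    unfolding Cons by (metis append_assoc red_append_red)
  also have "\<dots> = red (transit A a p None @ transit A a None (Some (letter_inv x)) @ core a x @ transit A a (Some x) None @ ?c)"
    by simp
  also have "\<dots> = red (transit A a p None @ whitehead_map A a x @ ?c)"
  proof -
    \<comment> \<open>For \<open>x = a\<close> the core is empty and the two transitions together
      yield \<open>a\<close>, since \<open>a\<close> lies in \<open>A\<close> and its inverse does
      not; similarly for the inverse.\<close>
    have "red (transit A a None (Some (letter_inv x)) @ core a x @ transit A a (Some x) None) = red (whitehead_map A a x)"
      using assms by (auto simp: whitehead_map_def core_def separates_def transit_def red_Cons)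
    from red_append_cong[OF refl red_append_cong[OF this refl], of _ ?c]
    show ?thesis by simp
  qed
  finally show ?case by simp
qed simp

text \<open>Each edge cut by \<open>A\<close> contributes one letter, and the dropped letters are
  those counted by \<open>occ\<close>.\<close>

lemma length_whitehead_word:
  "length (whitehead_word A a p w) + occ a w = length w + cap A p w"
  by (induction w arbitrary: p) (auto simp: occ_def core_def transit_def)

text \<open>\<open>core\<close> drops \<open>a\<close> and its inverse, so letters that were apart
  may become neighbours. The induction therefore records how the output can begin after
  \<open>p\<close>: after \<open>a\<close>, with \<open>a\<close> or with a letter whose inverse is
  in \<open>A\<close>, hence never with the inverse of an ordinary letter outside \<open>A\<close>;
  dually after the inverse of \<open>a\<close>.\<close>

lemma reduced_whitehead_word:
  assumes A: "separates A a"
  shows "reduced w \<Longrightarrow> (case p of None \<Rightarrow> True | Some x \<Rightarrow> w = [] \<or> hd w \<noteq> letter_inv x) \<Longrightarrow>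
    reduced (whitehead_word A a p w) \<and>
    (\<forall>z v. whitehead_word A a p w = z # v \<longrightarrow>
       (p = Some a \<longrightarrow> z \<noteq> letter_inv a \<and> (z = a \<or> Some (letter_inv z) \<in> A)) \<and>
       (p = Some (letter_inv a) \<longrightarrow> z \<noteq> a \<and> (z = letter_inv a \<or> Some (letter_inv z) \<notin> A)) \<and>
       (\<forall>x. p = Some x \<longrightarrow> x \<noteq> a \<longrightarrow> x \<noteq> letter_inv a \<longrightarrow> z \<noteq> letter_inv x))"
proof (induction w arbitrary: p)
  case Nil
  then show ?case
    using A by (auto simp: transit_def separates_def letter_inv_swap)
next
  case (Cons x w)
  have r: "reduced w" "case Some x of None \<Rightarrow> True | Some x \<Rightarrow> w = [] \<or> hd w \<noteq> letter_inv x"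
    using Cons.prems(1) by (auto simp: reduced_Cons_iff)
  define out where "out = whitehead_word A a (Some x) w"
  have px: "p \<noteq> Some (letter_inv x)"
    using Cons.prems(2) by auto
  have IH1: "reduced out" 
    using Cons.IH[OF r] by (simp add: out_def)
  have IH2: "z \<noteq> letter_inv a \<and> (z = a \<or> Some (letter_inv z) \<in> A)" if "out = z # v" "x = a" for z v
    using Cons.IH[OF r, folded out_def] that by blast
  have IH3: "z \<noteq> a \<and> (z = letter_inv a \<or> Some (letter_inv z) \<notin> A)" if "out = z # v" "x = letter_inv a" for z v
    using Cons.IH[OF r, folded out_def] that by blast
  have IH4: "z \<noteq> letter_inv x" if "out = z # v" "x \<noteq> a" "x \<noteq> letter_inv a" for z v
    using Cons.IH[OF r, folded out_def] that by blast
  have eq: "whitehead_word A a p (x # w) = transit A a p (Some (letter_inv x)) @ core a x @ out"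
    by (simp add: out_def)
  consider "x = a" | "x = letter_inv a" | "x \<noteq> a" "x \<noteq> letter_inv a" by blast
  then show ?case
  proof cases
    case 1
    then show ?thesis unfolding eq using A IH1 IH2 px
      by (cases out) (auto simp: core_def transit_def separates_def reduced_Cons_iff letter_inv_swap)
  next
    case 2
    then show ?thesis unfolding eq using A IH1 IH3 px
      by (cases out) (auto simp: core_def transit_def separates_def reduced_Cons_iff letter_inv_swap)
  next
    case 3
    then show ?thesis unfolding eq using A IH1 IH4 px
      by (cases out) (auto simp: core_def transit_def separates_def reduced_Cons_iff letter_inv_swap)
  qed
qed

lemma whitehead_eq_whitehead_word:
  assumes "separates A a" "reduced w"
  shows "whitehead A a w = whitehead_word A a None w"
  using reduced_whitehead_word[OF assms, of None] red_whitehead_word[OF assms(1), of None w]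
  by (simp add: lift_hom_def transit_def red_reduced)

lemma length_whitehead:
  assumes "separates A a" "reduced w"
  shows "length (whitehead A a w) + occ a w = length w + cap A None w"
  using length_whitehead_word[of A a None w] by (simp add: whitehead_eq_whitehead_word assms)

text \<open>Every change made by \<open>(A, a)\<close> inserts or removes \<open>a\<close> or its
  inverse, both outside \<open>B\<close>, at a place where one neighbouring vertex lies in
  \<open>A\<close>, hence also outside \<open>B\<close>. So no additional edge cut by
  \<open>B\<close> arises.\<close>

lemma cap_whitehead_word_le:
  assumes "Some a \<notin> B" "Some (letter_inv a) \<notin> B" "A \<inter> B = {}" "separates A a"
  shows "cap B p (whitehead_word A a p w) \<le> cap B p w"
proof (induction w arbitrary: p)
  case Nil
  then show ?case using assms by (auto simp: transit_def)
next
  case (Cons x w)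
  show ?case using assms Cons[of "Some x"]
    by (cases "whitehead_word A a (Some x) w") (auto simp: transit_def core_def of_bool_def separates_def split: if_splits)
qed

lemma occ_whitehead_word:
  assumes "b \<noteq> a" "b \<noteq> letter_inv a"
  shows "occ b (whitehead_word A a p w) = occ b w"
  using assms
    by (induction w arbitrary: p) (auto simp: occ_def transit_def core_def letter_inv_swap)

text \<open>On the image under \<open>(A, a)\<close> the letter \<open>b\<close> occurs as often as
  before and \<open>B\<close> has no larger capacity, so the two length changes at worst add
  up.\<close>

lemma length_whitehead_whitehead_le:
  assumes "separates A a" "separates B b" "A \<inter> B = {}" "Some (letter_inv a) \<notin> B" "reduced w"
  shows "length (whitehead B b (whitehead A a w)) + occ a w + occ b w
           \<le> length w + cap A None w + cap B None w"
proof -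
  have b: "b \<noteq> a" "b \<noteq> letter_inv a" and a: "Some a \<notin> B"
    using assms by (auto simp: separates_def)
  show ?thesis
    using reduced_lift_hom[of "whitehead_map A a" w] length_whitehead[OF assms(1,5)] length_whitehead[OF assms(2), of "whitehead A a w"]
      cap_whitehead_word_le[OF a assms(4,3,1), of None w] occ_whitehead_word[OF b, of A None w] assms
    by (simp add: whitehead_eq_whitehead_word)
qed

section \<open>Relations between Whitehead automorphisms\<close>

lemma whitehead_inverse:
  assumes "separates A a"
  shows "whitehead (insert (Some (letter_inv a)) (A - {Some a})) (letter_inv a) (whitehead A a w) = red w"
proof -
  let ?D = "insert (Some (letter_inv a)) (A - {Some a})"
  have "red (concat (map (whitehead_map ?D (letter_inv a)) (whitehead_map A a x))) = red [x]" for x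
    using assms
    by (auto simp: whitehead_map_def transit_def separates_def letter_inv_swap red_Cons)
  then have "whitehead ?D (letter_inv a) (whitehead A a w) = lift_hom (\<lambda>x. [x]) w"
    unfolding lift_hom_lift_hom[OF respects_inv_whitehead_map] by (intro lift_hom_cong) blast
  then show ?thesis by (simp add: lift_hom_singletons)
qed

text \<open>With one fixed multiplier the attached powers of \<open>a\<close> add, so the part of
  \<open>B\<close> outside \<open>A\<close> can be applied separately.\<close>

lemma whitehead_factor:
  assumes "separates A a" "separates B a" "A \<subseteq> B"
  shows "whitehead (insert (Some a) (B - A)) a (whitehead A a w) = whitehead B a w"
proof -
  have "red (concat (map (whitehead_map (insert (Some a) (B - A)) a) (whitehead_map A a x))) = red (whitehead_map B a x)" for x
    using assms
    by (auto simp: whitehead_map_def transit_def separates_def letter_inv_swap red_Cons)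
  then show ?thesis
    unfolding lift_hom_lift_hom[OF respects_inv_whitehead_map]
    by (intro lift_hom_cong) blast
qed

lemma whitehead_commute:
  assumes "separates A a" "separates B b" "A \<inter> B = {}" "Some (letter_inv a) \<notin> B"
    "Some (letter_inv b) \<notin> A"
  shows "whitehead B b (whitehead A a w) = whitehead A a (whitehead B b w)"
proof -
  have "b \<noteq> a" "b \<noteq> letter_inv a" "Some b \<notin> A" "Some a \<notin> B" using assms
    by (auto simp: separates_def)
  then have "red (concat (map (whitehead_map B b) (whitehead_map A a x))) = 
        red (concat (map (whitehead_map A a) (whitehead_map B b x)))" for x
    using assms
    by (auto simp: whitehead_map_def transit_def separates_def letter_inv_swap red_Cons)
  then show ?thesis
    by (intro lift_hom_comp_eqI) auto
qed

text \<open>The signed 4-cycle from \<open>a\<close> to \<open>c\<close>, to the inverse of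
  \<open>a\<close>, to the inverse of \<open>c\<close> and back to \<open>a\<close>. It is the
  correction in the relation that changes the multiplier of a fixed set.\<close>

definition cycle_perm :: "letter \<Rightarrow> letter \<Rightarrow> letter \<Rightarrow> letter" where
  "cycle_perm a c x = (if x = a then c else if x = letter_inv a then letter_inv c else
     if x = c then letter_inv a else if x = letter_inv c then a else x)"

lemma whitehead_change_multiplier:
  assumes "separates A a" "separates A c" "a \<noteq> c" "None \<notin> A"
  shows "whitehead (A - {Some a, Some c} \<union> {Some (letter_inv a), Some (letter_inv c)}) (letter_inv a)
     (lift_hom (\<lambda>x. [cycle_perm a c x]) (whitehead A a w)) = whitehead A c w"
proof -
  let ?D = "A - {Some a, Some c} \<union> {Some (letter_inv a), Some (letter_inv c)}"
  have ac: "c \<noteq> letter_inv a" "a \<noteq> letter_inv c" using assms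
    by (auto simp: separates_def)
  have "red (concat (map (whitehead_map ?D (letter_inv a)) (concat (map (\<lambda>x. [cycle_perm a c x]) (whitehead_map A a x)))))
      = red (whitehead_map A c x)" for x
    using assms ac
    by (auto simp: whitehead_map_def transit_def separates_def letter_inv_swap red_Cons cycle_perm_def)
  moreover have "respects_inv (\<lambda>x. [cycle_perm a c x])"
    using assms ac unfolding respects_inv_def
      by (auto simp: cycle_perm_def winv_def letter_inv_swap)
  ultimately show ?thesis
    by (auto simp: lift_hom_lift_hom intro: lift_hom_cong)
qed

text \<open>On the right an attached \<open>b\<close> becomes the inverse of \<open>a\<close> times
  \<open>b\<close>, as the inverse of \<open>b\<close> lies in \<open>A\<close> (marker outside both
  sets); adding the letters of \<open>B\<close> to the set supplies the \<open>a\<close> that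
  cancels this.\<close>

lemma whitehead_exchange:
  assumes "separates A a" "separates B b" "A \<inter> B = {}" "Some (letter_inv a) \<notin> B"
    "Some (letter_inv b) \<in> A"
  shows "whitehead B b (whitehead A a w) = whitehead (A \<union> B - {Some b}) a (whitehead B b w)"
proof -
  have "b \<noteq> a" "b \<noteq> letter_inv a" "Some b \<notin> A" "Some a \<notin> B" "Some (letter_inv a) \<notin> A" "Some (letter_inv b) \<notin> B"
    "letter_inv b \<noteq> a"
    using assms by (auto simp: separates_def)
  then have "red (concat (map (whitehead_map B b) (whitehead_map A a x))) = 
        red (concat (map (whitehead_map (A \<union> B - {Some b}) a) (whitehead_map B b x)))" for x
    using assms
    by (auto simp: whitehead_map_def transit_def separates_def letter_inv_swap red_Cons)
  then show ?thesis
    by (intro lift_hom_comp_eqI) auto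
qed

section \<open>Steps up to signed permutations\<close>

definition signed_perm :: "nat \<Rightarrow> (letter \<Rightarrow> letter) \<Rightarrow> bool" where
  "signed_perm n \<rho> \<longleftrightarrow> \<rho> permutes letters n \<and> (\<forall>x. \<rho> (letter_inv x) = letter_inv (\<rho> x))"

text \<open>Signed permutations are built into the steps because they do not change lengths.\<close>

definition whitehead_step :: "nat \<Rightarrow> word \<Rightarrow> word \<Rightarrow> bool" where
  "whitehead_step n x y \<longleftrightarrow>
     (\<exists>\<rho> A a. signed_perm n \<rho> \<and> separates A a \<and> a \<in> letters n \<and> y = map \<rho> (whitehead A a x))"

abbreviation perm_inv :: "('a \<Rightarrow> 'a) \<Rightarrow> 'a \<Rightarrow> 'a" where
  "perm_inv \<equiv> inv_into UNIV"

lemma signed_permD: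
  assumes "signed_perm n \<rho>"
  shows "\<rho> permutes letters n" "\<rho> (letter_inv x) = letter_inv (\<rho> x)" "inj \<rho>"
    "\<rho> x \<in> letters n \<longleftrightarrow> x \<in> letters n"
  using assms unfolding signed_perm_def
    by (blast, blast, metis permutes_inj, metis permutes_in_image)

lemma signed_perm_id: "signed_perm n id"
  by (simp add: signed_perm_def permutes_id)

lemma signed_perm_comp: "signed_perm n \<rho> \<Longrightarrow> signed_perm n \<sigma> \<Longrightarrow> signed_perm n (\<rho> \<circ> \<sigma>)"
  unfolding signed_perm_def by (simp add: permutes_compose del: split_paired_All)

lemma signed_perm_inv:
  assumes "signed_perm n \<rho>"
  shows "signed_perm n (perm_inv \<rho>)"
proof -
  have p: "\<rho> permutes letters n" using assms by (rule signed_permD)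
  have "perm_inv \<rho> (letter_inv x) = letter_inv (perm_inv \<rho> x)" for x
    using signed_permD(2)[OF assms, of "perm_inv \<rho> x"] permutes_inverses[OF p] by metis
  then show ?thesis using permutes_inv[OF p] unfolding signed_perm_def by blast
qed

lemma map_inv_signed_perm:
  assumes "signed_perm n \<rho>"
  shows "map \<rho> (map (perm_inv \<rho>) w) = w" "map (perm_inv \<rho>) (map \<rho> w) = w"
  using permutes_inverses[OF signed_permD(1)[OF assms]] by (simp_all add: comp_def)

lemma map_red:
  assumes "signed_perm n \<rho>"
  shows "map \<rho> (red w) = red (map \<rho> w)"
proof (induction w)
  case (Cons x w)
  have "map \<rho> (cons_reduce x r) = cons_reduce (\<rho> x) (map \<rho> r)" for r
  proof (cases r)
    case (Cons y ys)
    have "\<rho> y = letter_inv (\<rho> x) \<longleftrightarrow> y = letter_inv x"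
      using signed_permD(2)[OF assms, of x] inj_eq[OF signed_permD(3)[OF assms]] by metis
    then show ?thesis using Cons by simp
  qed simp
  then show ?case using Cons by (simp add: red_Cons)
qed simp

lemma map_signed_perm_carrier:
  assumes "signed_perm n \<rho>" "w \<in> carrier (free_group n)"
  shows "map \<rho> w \<in> carrier (free_group n)"
proof -
  have "red (map \<rho> w) = map \<rho> w"
    using assms(2) by (simp add: map_red[OF assms(1), symmetric] red_reduced carrier_free_group)
  then have "reduced (map \<rho> w)" by (metis reduced_red)
  then show ?thesis using assms signed_permD(4)[OF assms(1)] by (auto simp: carrier_free_group)
qed

lemma map_whitehead:
  assumes "signed_perm n \<rho>"
  shows "map \<rho> (whitehead A a w) = whitehead (map_option \<rho> ` A) (\<rho> a) (map \<rho> w)"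
proof -
  have mem: "map_option \<rho> p \<in> map_option \<rho> ` A \<longleftrightarrow> p \<in> A" for p
    by (rule inj_image_mem_iff[OF option.inj_map[OF signed_permD(3)[OF assms]]])
  have tr: "map \<rho> (transit A a p q) = transit (map_option \<rho> ` A) (\<rho> a) (map_option \<rho> p) (map_option \<rho> q)" for p q
    unfolding transit_def mem by (simp add: signed_permD(2)[OF assms])
  have "map \<rho> (whitehead_map A a x) = whitehead_map (map_option \<rho> ` A) (\<rho> a) (\<rho> x)" for x
    using tr[of None "Some (letter_inv x)"] tr[of "Some x" None] injD[OF signed_permD(3)[OF assms]]
      signed_permD(2)[OF assms]
    by (auto simp: whitehead_map_def)
  then have "map \<rho> (concat (map (whitehead_map A a) w)) =
     concat (map (whitehead_map (map_option \<rho> ` A) (\<rho> a)) (map \<rho> w))"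
    by (simp add: map_concat comp_def)
  then show ?thesis by (simp add: lift_hom_def map_red[OF assms])
qed

lemma separates_image:
  assumes "signed_perm n \<rho>" "separates A a"
  shows "separates (map_option \<rho> ` A) (\<rho> a)"
proof -
  have mem: "Some (\<rho> x) \<in> map_option \<rho> ` A \<longleftrightarrow> Some x \<in> A" for x
    using inj_image_mem_iff[OF option.inj_map[OF signed_permD(3)[OF assms(1)]], of "Some x" A] by simp
  show ?thesis using assms(2) mem[of a] mem[of "letter_inv a"] 
    by (simp add: separates_def signed_permD(2)[OF assms(1)])
qed

lemma whitehead_stepI:
  "signed_perm n \<rho> \<Longrightarrow> separates A a \<Longrightarrow> a \<in> letters n \<Longrightarrow> whitehead_step n x (map \<rho> (whitehead A a x))"
  unfolding whitehead_step_def by blast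

lemma whitehead_step_whitehead:
  "separates A a \<Longrightarrow> a \<in> letters n \<Longrightarrow> whitehead_step n x (whitehead A a x)"
  using whitehead_stepI[OF signed_perm_id, of A a n x] by simp

lemma whitehead_trivial: "whitehead {Some a} a w = red w"
proof -
  have "whitehead_map {Some a} a = (\<lambda>x. [x])"
    by (auto simp: whitehead_map_def transit_def letter_inv_swap fun_eq_iff)
  then show ?thesis by (simp add: lift_hom_singletons)
qed

text \<open>A step always involves a Whitehead pair; the set consisting of its multiplier alone
  gives the identity.\<close>

lemma whitehead_step_map:
  assumes "signed_perm n \<rho>" "reduced w" "a \<in> letters n"
  shows "whitehead_step n w (map \<rho> w)"
  using whitehead_stepI[OF assms(1), of "{Some a}" a w] assms
  by (simp add: whitehead_trivial red_reduced separates_def)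

lemma whitehead_carrier:
  assumes "a \<in> letters n" "w \<in> carrier (free_group n)"
  shows "whitehead A a w \<in> carrier (free_group n)"
  using assms
    by (intro lift_hom_in_carrier) (auto simp: carrier_free_group whitehead_map_def transit_def split: if_splits)

lemma whitehead_step_carrier:
  assumes "whitehead_step n x y" "x \<in> carrier (free_group n)"
  shows "y \<in> carrier (free_group n)"
  using assms by (auto simp: whitehead_step_def intro: map_signed_perm_carrier whitehead_carrier)

lemma whitehead_step_map_right:
  assumes "whitehead_step n x y" "signed_perm n \<rho>"
  shows "whitehead_step n x (map \<rho> y)"
proof -
  obtain \<sigma> A a where *: "signed_perm n \<sigma>" "separates A a" "a \<in> letters n" "y = map \<sigma> (whitehead A a x)"
    using assms(1) by (auto simp: whitehead_step_def)
  show ?thesis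
    using whitehead_stepI[OF signed_perm_comp[OF assms(2) *(1)] *(2,3), of x] *(4) by simp
qed

text \<open>A signed permutation moves past a Whitehead automorphism by renaming its set and
  multiplier, and is then absorbed by the permutation of the step.\<close>

lemma whitehead_step_map_left:
  assumes "whitehead_step n (map \<rho> x) y" "signed_perm n \<rho>"
  shows "whitehead_step n x y"
proof -
  obtain \<sigma> A a where *: "signed_perm n \<sigma>" "separates A a" "a \<in> letters n" "y = map \<sigma> (whitehead A a (map \<rho> x))"
    using assms(1) by (auto simp: whitehead_step_def)
  have i: "signed_perm n (perm_inv \<rho>)" using assms(2) by (rule signed_perm_inv)
  have "map (perm_inv \<rho>) (whitehead A a (map \<rho> x)) = whitehead (map_option (perm_inv \<rho>) ` A) (perm_inv \<rho> a) x"
    by (simp only: map_whitehead[OF i] map_inv_signed_perm[OF assms(2)])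
  then have "whitehead A a (map \<rho> x) = map \<rho> (whitehead (map_option (perm_inv \<rho>) ` A) (perm_inv \<rho> a) x)"
    by (metis map_inv_signed_perm(1)[OF assms(2)])
  then have "y = map (\<sigma> \<circ> \<rho>) (whitehead (map_option (perm_inv \<rho>) ` A) (perm_inv \<rho> a) x)"
    using * by simp
  then show ?thesis
    using whitehead_stepI[OF signed_perm_comp[OF *(1) assms(2)] separates_image[OF i *(2)]]
      signed_permD(4)[OF i] *(3) by simp
qed

lemma separates_inverse: "separates A a \<Longrightarrow> separates (insert (Some (letter_inv a)) (A - {Some a})) (letter_inv a)"
  by (simp add: separates_def)

lemma whitehead_step_sym:
  assumes "whitehead_step n x y" "reduced x"
  shows "whitehead_step n y x"
proof -
  obtain \<rho> A a where *: "signed_perm n \<rho>" "separates A a" "a \<in> letters n" "y = map \<rho> (whitehead A a x)"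
    using assms(1) by (auto simp: whitehead_step_def)
  have "whitehead_step n (whitehead A a x) x"
    using whitehead_step_whitehead[OF separates_inverse[OF *(2)], of n "whitehead A a x"] *(3)
    by (simp add: whitehead_inverse[OF *(2)] red_reduced[OF assms(2)])
  moreover have "map (perm_inv \<rho>) y = whitehead A a x"
    using *(4) map_inv_signed_perm[OF *(1)] by simp
  ultimately show ?thesis
    using whitehead_step_map_left[OF _ signed_perm_inv[OF *(1)], of y x] by simp
qed

text \<open>The complement of \<open>B\<close> carries the multiplier \<open>a\<close> and contains
  \<open>A\<close>, so the two maps differ by one Whitehead automorphism with multiplier
  \<open>a\<close>.\<close>

lemma whitehead_step_opposite:
  assumes "separates A a" "separates B (letter_inv a)" "A \<inter> B = {}" "a \<in> letters n"
  shows "whitehead_step n (whitehead A a w) (whitehead B (letter_inv a) w)"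
proof -
  have s: "separates (- B) a" using separates_Compl[OF assms(2)] by simp
  have "whitehead B (letter_inv a) w = whitehead (- B) a w"
    using whitehead_map_Compl[of B "letter_inv a"] by simp
  also have "whitehead (- B) a w = whitehead (insert (Some a) (- B - A)) a (whitehead A a w)"
    by (rule whitehead_factor[OF assms(1) s, symmetric]) (use assms(3) in auto)
  finally show ?thesis
    using whitehead_step_whitehead[of "insert (Some a) (- B - A)" a n "whitehead A a w"] s assms(4)
    by (simp add: separates_def)
qed

lemma finite_letters [simp]: "finite (letters n)"
  by (simp add: letters_def)

lemma signed_perm_cycle_perm:
  assumes "a \<in> letters n" "c \<in> letters n" "a \<noteq> c" "a \<noteq> letter_inv c"
  shows "signed_perm n (cycle_perm a c)"
proof -
  have inj: "inj (cycle_perm a c)"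
    using assms(3,4) by (intro injI) (auto simp: cycle_perm_def letter_inv_swap split: if_splits)
  have "cycle_perm a c ` letters n \<subseteq> letters n"
    using assms by (auto simp: cycle_perm_def)
  then have "bij_betw (cycle_perm a c) (letters n) (letters n)"
    unfolding bij_betw_def using inj_on_subset[OF inj subset_UNIV] endo_inj_surj[OF finite_letters] by metis
  moreover have "cycle_perm a c x = x" if "x \<notin> letters n" for x
    using assms(1,2) that by (auto simp: cycle_perm_def)
  ultimately have "cycle_perm a c permutes letters n"
    by (rule bij_imp_permutes)
  moreover have "cycle_perm a c (letter_inv x) = letter_inv (cycle_perm a c x)" for x
    using assms(3,4) by (auto simp: cycle_perm_def letter_inv_swap)
  ultimately show ?thesis unfolding signed_perm_def by blast
qed

lemma whitehead_step_same_set: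
  assumes "separates A a" "separates A c" "a \<in> letters n" "c \<in> letters n"
  shows "whitehead_step n (whitehead A a w) (whitehead A c w)"
proof (cases "a = c")
  case True
  then show ?thesis
    using whitehead_step_map[OF signed_perm_id _ assms(3), of "whitehead A a w"] by simp
next
  case False
  have main: "whitehead_step n (whitehead A a w) (whitehead A c w)"
    if A: "separates A a" "separates A c" "a \<in> letters n" "c \<in> letters n" "a \<noteq> c" "None \<notin> A" for A a c
  proof -
    define D where "D = A - {Some a, Some c} \<union> {Some (letter_inv a), Some (letter_inv c)}"
    have ac: "a \<noteq> letter_inv c" using A by (auto simp: separates_def)
    have rho: "signed_perm n (cycle_perm a c)"
      using A ac by (intro signed_perm_cycle_perm)
    have "concat (map (\<lambda>x. [cycle_perm a c x]) v) = map (cycle_perm a c) v" for v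
      by (induction v) auto
    then have "lift_hom (\<lambda>x. [cycle_perm a c x]) (whitehead A a w) = map (cycle_perm a c) (whitehead A a w)"
      using map_red[OF rho, of "whitehead A a w"] by (simp add: lift_hom_def)
    then have "whitehead A c w = whitehead D (letter_inv a) (map (cycle_perm a c) (whitehead A a w))"
      using whitehead_change_multiplier[OF A(1,2,5,6), of w] by (simp add: D_def)
    moreover have "separates D (letter_inv a)"
      using A ac by (simp add: D_def separates_def)
    ultimately have "whitehead_step n (map (cycle_perm a c) (whitehead A a w)) (whitehead A c w)"
      using A(3) whitehead_step_whitehead by simp
    then show ?thesis using rho by (rule whitehead_step_map_left)
  qed
  show ?thesis
  \<comment> \<open>A set containing the marker is replaced by its complement with inverse
    multipliers, which defines the same maps.\<close>
  proof (cases "None \<in> A")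
    case True
    then show ?thesis
      using main[of "- A" "letter_inv a" "letter_inv c"] False assms
      by (simp add: whitehead_map_Compl separates_Compl)
  qed (use main False assms in blast)
qed

section \<open>Peak reduction\<close>

text \<open>Only the inner words of the path have to be shorter than \<open>h\<close>.\<close>

inductive low_path :: "nat \<Rightarrow> nat \<Rightarrow> word \<Rightarrow> word \<Rightarrow> bool" for n h where
  single: "whitehead_step n x y \<Longrightarrow> low_path n h x y"
| snoc: "low_path n h x y \<Longrightarrow> length y < h \<Longrightarrow> whitehead_step n y z \<Longrightarrow> low_path n h x z"

lemma low_path_trans:
  assumes "low_path n h y z" "low_path n h x y" "length y < h"
  shows "low_path n h x z"
  using assms by (induction rule: low_path.induct) (auto intro: low_path.intros)

lemma low_path_via:
  "whitehead_step n x y \<Longrightarrow> length y < h \<Longrightarrow> whitehead_step n y z \<Longrightarrow> low_path n h x z"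
  by (blast intro: low_path.intros)

text \<open>The corner opposite to the peak \<open>w\<close>. From the side of \<open>B\<close> it
  is reached by \<open>(A, a)\<close> itself or, if the inverse of \<open>b\<close> lies in
  \<open>A\<close>, by the enlarged set of the exchange relation.\<close>

lemma whitehead_square:
  assumes "separates A a" "separates B b" "A \<inter> B = {}" "Some (letter_inv a) \<notin> B"
    "a \<in> letters n" "b \<in> letters n"
  shows "whitehead_step n (whitehead A a w) (whitehead B b (whitehead A a w))"
    "whitehead_step n (whitehead B b w) (whitehead B b (whitehead A a w))"
proof -
  show "whitehead_step n (whitehead A a w) (whitehead B b (whitehead A a w))"
    using assms by (intro whitehead_step_whitehead)
  have "separates (A \<union> B - {Some b}) a"
    using assms by (auto simp: separates_def)
  then show "whitehead_step n (whitehead B b w) (whitehead B b (whitehead A a w))"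
    using assms whitehead_commute[OF assms(1-4), of w] whitehead_exchange[OF assms(1-4), of w]
    by (cases "Some (letter_inv b) \<in> A") (auto intro!: whitehead_step_whitehead)
qed

text \<open>
  In the last case neither order of the two automorphisms helps, but both sets separate both
  multipliers, and exchanging the multipliers makes one of the automorphisms shortening.
\<close>

lemma low_path_disjoint:
  assumes A: "separates A a" "a \<in> letters n" "cap A None w \<le> occ a w"
    and B: "separates B b" "b \<in> letters n" "cap B None w \<le> occ b w"
    and lt: "cap A None w + cap B None w < occ a w + occ b w"
    and "A \<inter> B = {}" "reduced w"
  shows "low_path n (length w) (whitehead A a w) (whitehead B b w)"
proof -
  consider "b = letter_inv a" | "Some (letter_inv a) \<notin> B" | "Some (letter_inv b) \<notin> A"
    | "b \<noteq> letter_inv a" "Some (letter_inv a) \<in> B" "Some (letter_inv b) \<in> A"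
    by blast
  then show ?thesis
  proof cases
    case 1
    then show ?thesis
      using whitehead_step_opposite[of A a B n w] assms by (auto intro: low_path.single)
  next
    case 2
    have "length (whitehead B b (whitehead A a w)) < length w"
      using length_whitehead_whitehead_le[OF A(1) B(1) \<open>A \<inter> B = {}\<close> 2 \<open>reduced w\<close>] lt by linarith
    moreover note whitehead_square[OF A(1) B(1) \<open>A \<inter> B = {}\<close> 2 A(2) B(2), of w]
    ultimately show ?thesis
      by (meson low_path_via whitehead_step_sym reduced_lift_hom)
  next
    case 3
    have BA: "B \<inter> A = {}" using assms by blast
    have "length (whitehead A a (whitehead B b w)) < length w"
      using length_whitehead_whitehead_le[OF B(1) A(1) BA 3 \<open>reduced w\<close>] lt by linarith
    moreover note whitehead_square[OF B(1) A(1) BA 3 B(2) A(2), of w]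
    ultimately show ?thesis
      by (meson low_path_via whitehead_step_sym reduced_lift_hom)
  next
    case 4
    have s: "separates A (letter_inv b)" "separates B (letter_inv a)"
      using 4 assms by (auto simp: separates_def)
    consider "cap A None w < occ b w" | "cap B None w < occ a w"
      using lt by linarith
    then show ?thesis
    proof cases
      case 1
      have "length (whitehead A (letter_inv b) w) < length w"
        using length_whitehead[OF s(1) \<open>reduced w\<close>] 1 by simp
      moreover have "whitehead_step n (whitehead A a w) (whitehead A (letter_inv b) w)"
        using s(1) assms by (intro whitehead_step_same_set) auto
      moreover have "whitehead_step n (whitehead A (letter_inv b) w) (whitehead B b w)"
        using whitehead_step_opposite[OF s(1), of B n w] assms by simp
      ultimately show ?thesis by (blast intro: low_path_via)
    next
      case 2
      have "length (whitehead B (letter_inv a) w) < length w"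
        using length_whitehead[OF s(2) \<open>reduced w\<close>] 2 by simp
      moreover have "whitehead_step n (whitehead A a w) (whitehead B (letter_inv a) w)"
        using s(2) assms by (intro whitehead_step_opposite) auto
      moreover have "whitehead_step n (whitehead B (letter_inv a) w) (whitehead B b w)"
        using s(2) assms by (intro whitehead_step_same_set) auto
      ultimately show ?thesis by (blast intro: low_path_via)
    qed
  qed
qed

text \<open>If \<open>Q\<close> lies inside \<open>A\<close>, passing to the complement of
  \<open>A\<close> with the inverse multiplier gives the disjoint case.\<close>

lemma low_path_compatible:
  assumes A: "separates A a" "a \<in> letters n" "cap A None w \<le> occ a w"
    and Q: "separates Q c" "c \<in> letters n" "cap Q None w < occ c w"
    and "Q \<subseteq> A \<or> Q \<subseteq> - A" "reduced w"
  shows "low_path n (length w) (whitehead A a w) (whitehead Q c w)"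
    "low_path n (length w) (whitehead Q c w) (whitehead A a w)"
proof -
  have "low_path n (length w) (whitehead A a w) (whitehead Q c w) \<and>
        low_path n (length w) (whitehead Q c w) (whitehead A a w)"
    using assms(7)
  proof
    assume "Q \<subseteq> - A"
    then have "A \<inter> Q = {}" "Q \<inter> A = {}" by blast+
    then show ?thesis
      using assms by (intro conjI low_path_disjoint) auto
  next
    assume "Q \<subseteq> A"
    then have "- A \<inter> Q = {}" "Q \<inter> - A = {}" by blast+
    then have "low_path n (length w) (whitehead (- A) (letter_inv a) w) (whitehead Q c w) \<and>
        low_path n (length w) (whitehead Q c w) (whitehead (- A) (letter_inv a) w)"
      using assms separates_Compl[OF A(1)] by (intro conjI low_path_disjoint) auto
    then show ?thesis by (simp add: whitehead_map_Compl)
  qed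
  then show "low_path n (length w) (whitehead A a w) (whitehead Q c w)"
    "low_path n (length w) (whitehead Q c w) (whitehead A a w)" by blast+
qed

text \<open>Each of \<open>a\<close>, \<open>b\<close> and their inverses lies in a corner that
  separates it from its inverse. Either two opposite corners serve \<open>a\<close> and
  \<open>b\<close>, or one opposite pair serves \<open>a\<close> and its inverse and the other pair
  \<open>b\<close> and its inverse. If no corner were shortening, submodularity would contradict the
  assumed inequality in both cases.\<close>

lemma reducing_corner:
  assumes A: "separates A a" "a \<in> letters n"
    and B: "separates B b" "b \<in> letters n"
    and lt: "cap A None w + cap B None w < occ a w + occ b w"
  obtains Q c where "separates Q c" "c \<in> letters n" "cap Q None w < occ c w"
    "Q \<subseteq> A \<or> Q \<subseteq> - A" "Q \<subseteq> B \<or> Q \<subseteq> - B"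
proof (rule ccontr)
  note witness = that
  assume "\<not> thesis"
  have H: "occ c w \<le> cap Q None w"
    if "separates Q c" "c \<in> {a, letter_inv a, b, letter_inv b}"
      "Q \<in> {A \<inter> B, A \<inter> - B, - A \<inter> B, - A \<inter> - B}" for Q c
  proof (rule ccontr)
    assume "\<not> occ c w \<le> cap Q None w"
    then have thesis
      using that A(2) B(2) by (intro witness[of Q c]) auto
    with \<open>\<not> thesis\<close> show False by simp
  qed
  \<comment> \<open>A union has the capacity of its complement, so submodularity becomes a bound for
    opposite corners.\<close>
  have "- (A \<union> B) = - A \<inter> - B" "- (A \<union> - B) = - A \<inter> B" by auto
  then have s: "cap (A \<inter> B) None w + cap (- A \<inter> - B) None w \<le> cap A None w + cap B None w"
    "cap (A \<inter> - B) None w + cap (- A \<inter> B) None w \<le> cap A None w + cap B None w"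
    using cap_submodular[of A B None w] cap_submodular[of A "- B" None w]
      cap_Compl[of "A \<union> B" None w] cap_Compl[of "A \<union> - B" None w] by simp_all
  have H': "occ a w \<le> cap Q None w \<or> \<not> separates Q a" "occ b w \<le> cap Q None w \<or> \<not> separates Q b"
      "occ a w \<le> cap Q None w \<or> \<not> separates Q (letter_inv a)"
      "occ b w \<le> cap Q None w \<or> \<not> separates Q (letter_inv b)"
    if "Q \<in> {A \<inter> B, A \<inter> - B, - A \<inter> B, - A \<inter> - B}" for Q
    using H[OF _ _ that, of a] H[OF _ _ that, of b] H[OF _ _ that, of "letter_inv a"] H[OF _ _ that, of "letter_inv b"]
    by auto
  note H4 = H'[of "A \<inter> B"] H'[of "A \<inter> - B"] H'[of "- A \<inter> B"] H'[of "- A \<inter> - B"]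
  show False
    using H4 A(1) B(1) s lt
    by (cases "Some a \<in> B"; cases "Some (letter_inv a) \<in> B"; cases "Some b \<in> A"; cases "Some (letter_inv b) \<in> A")
      (simp_all add: separates_def)
qed

text \<open>The image under a shortening corner \<open>Q\<close> lies below the peak, and
  \<open>Q\<close> is compatible with both sets, so the detour passes through that image.\<close>

lemma peak_reduction:
  assumes "whitehead_step n w x" "whitehead_step n w y" "length x < length w" "length y \<le> length w"
    and "reduced w"
  shows "low_path n (length w) x y"
proof -
  obtain \<rho> A a where x: "signed_perm n \<rho>" "separates A a" "a \<in> letters n" "x = map \<rho> (whitehead A a w)"
    using assms(1) by (auto simp: whitehead_step_def)
  obtain \<sigma> B b where y: "signed_perm n \<sigma>" "separates B b" "b \<in> letters n" "y = map \<sigma> (whitehead B b w)"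
    using assms(2) by (auto simp: whitehead_step_def)
  have A: "cap A None w < occ a w"
    using length_whitehead[OF x(2) assms(5)] assms(3) x(4) by simp
  have B: "cap B None w \<le> occ b w"
    using length_whitehead[OF y(2) assms(5)] assms(4) y(4) by simp
  obtain Q c where Q: "separates Q c" "c \<in> letters n" "cap Q None w < occ c w"
    "Q \<subseteq> A \<or> Q \<subseteq> - A" "Q \<subseteq> B \<or> Q \<subseteq> - B"
    using reducing_corner[OF x(2,3) y(2,3), of w] A B by (metis add_less_le_mono)
  have lenA: "length (whitehead A a w) < length w" and lenQ: "length (whitehead Q c w) < length w"
    using length_whitehead[OF x(2) assms(5)] length_whitehead[OF Q(1) assms(5)] A Q(3) by simp_all
  have "low_path n (length w) (whitehead A a w) (whitehead Q c w)"
    using low_path_compatible(1)[OF x(2,3) _ Q(1-4) assms(5)] A by simp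
  moreover have "low_path n (length w) (whitehead Q c w) (whitehead B b w)"
    using low_path_compatible(2)[OF y(2,3) B Q(1-3,5) assms(5)] .
  ultimately have AB: "low_path n (length w) (whitehead A a w) (whitehead B b w)"
    using low_path_trans lenQ by blast
  have "whitehead_step n (whitehead A a w) x"
    using whitehead_step_map[OF x(1) _ x(3)] x(4) by simp
  then have "whitehead_step n x (whitehead A a w)"
    using whitehead_step_sym by simp
  then have xB: "low_path n (length w) x (whitehead B b w)"
    using low_path_trans[OF AB] lenA by (blast intro: low_path.single)
  \<comment> \<open>\<open>whitehead B b w\<close> may be as long as \<open>w\<close> and so cannot
    be an inner word; the permutation in \<open>y\<close> is absorbed by the last step
    instead.\<close>
  then show ?thesis
    unfolding y(4)
    using y(1) by cases (blast intro: low_path.intros whitehead_step_map_right)+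
qed

section \<open>Lowering whole paths\<close>

definition level_conn :: "nat \<Rightarrow> nat \<Rightarrow> word \<Rightarrow> word \<Rightarrow> bool" where
  "level_conn n h = (\<lambda>x y. whitehead_step n x y \<and> length x \<le> h \<and> length y \<le> h)\<^sup>*\<^sup>*"

lemma low_path_level_conn:
  assumes "low_path n (Suc h) x y" "length x \<le> h"
  shows "\<exists>z. level_conn n h x z \<and> length z \<le> h \<and> whitehead_step n z y"
  using assms
proof (induction rule: low_path.induct)
  case (snoc x y z)
  then obtain v where "level_conn n h x v" "length v \<le> h" "whitehead_step n v y" by blast
  then have "level_conn n h x y"
    unfolding level_conn_def using snoc.hyps(2) by (auto intro: rtranclp.rtrancl_into_rtrancl)
  then show ?case using snoc.hyps by auto
qed (auto simp: level_conn_def)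

text \<open>Walks along the path and keeps a word \<open>z\<close> of length at most
  \<open>h\<close> at most one step behind the current word. If the current word has length
  \<open>Suc h\<close>, the step back to \<open>z\<close> and the step forward form a peak; plateaus
  are included because peak reduction lets the forward neighbour be as long as the peak.\<close>

lemma level_conn_lower:
  assumes "level_conn n (Suc h) x y" "x \<in> carrier (free_group n)" "length x \<le> h" "length y \<le> h"
  shows "level_conn n h x y"
proof -
  have "y \<in> carrier (free_group n) \<and>
    (\<exists>z \<in> carrier (free_group n). level_conn n h x z \<and> length z \<le> h \<and> (z = y \<or> whitehead_step n z y))"
    using assms(1) unfolding level_conn_def[of n "Suc h"]
  proof (induction rule: rtranclp_induct)
    case base
    then show ?case using assms by (auto simp: level_conn_def)
  next
    case (step p q)
    then obtain z where z: "z \<in> carrier (free_group n)" "level_conn n h x z" "length z \<le> h"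
      "z = p \<or> whitehead_step n z p" and p: "p \<in> carrier (free_group n)" by blast
    have q: "q \<in> carrier (free_group n)"
      using step.hyps(2) p whitehead_step_carrier by blast
    show ?case
    proof (cases "length p \<le> h")
      case True
      then have "level_conn n h x p"
        using z unfolding level_conn_def by (auto intro: rtranclp.rtrancl_into_rtrancl)
      then show ?thesis using True p q step.hyps(2) by blast
    next
      case False
      then have lp: "length p = Suc h" using step.hyps(2) by linarith
      have "whitehead_step n p z"
        using z(1,3,4) False whitehead_step_sym[of n z p] by (auto simp: carrier_free_group)
      then have "low_path n (Suc h) z q"
        using peak_reduction[of n p z q] step.hyps(2) lp z(3) p by (simp add: carrier_free_group)
      from low_path_level_conn[OF this z(3)] obtain v where
        v: "level_conn n h z v" "length v \<le> h" "whitehead_step n v q" by blast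
      have "v \<in> carrier (free_group n)"
        using v(1) z(1) unfolding level_conn_def
        by (induction rule: rtranclp_induct) (auto intro: whitehead_step_carrier)
      moreover have "level_conn n h x v"
        using z(2) v(1) unfolding level_conn_def by simp
      ultimately show ?thesis using v q by blast
    qed
  qed
  then show ?thesis
    using assms(4) unfolding level_conn_def by (auto intro: rtranclp.rtrancl_into_rtrancl)
qed

text \<open>A finite path stays below some level, which is then lowered one unit at a time.\<close>

lemma level_conn_min:
  assumes "(whitehead_step n)\<^sup>*\<^sup>* x y" "x \<in> carrier (free_group n)" "length y = length x"
  shows "level_conn n (length x) x y"
proof -
  have "\<exists>h. level_conn n (length x + h) x y"
    using assms(1)
  proof (induction rule: rtranclp_induct)
    case (step y z)
    then obtain h where h: "level_conn n (length x + h) x y" by blast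
    define k where "k = h + length y + length z"
    have "level_conn n (length x + k) x y"
      using h unfolding level_conn_def
      by (rule rtranclp_mono[THEN predicate2D, rotated]) (auto simp: k_def)
    then have "level_conn n (length x + k) x z"
      using step unfolding level_conn_def by (auto intro: rtranclp.rtrancl_into_rtrancl simp: k_def)
    then show ?case by blast
  qed (auto simp: level_conn_def)
  then obtain h where "level_conn n (length x + h) x y" by blast
  then show ?thesis
    using level_conn_lower[of n "length x + _" x y] assms(2,3) by (induction h) auto
qed

section \<open>Nielsen reduction\<close>

lemma cancel_decomp:
  assumes "reduced u" "reduced v"
  obtains s p t where "u = s @ p" "v = winv p @ t" "reduced (s @ t)"
proof -
  have "\<exists>s p t. u = s @ p \<and> v = winv p @ t \<and> reduced (s @ t)"
    using assms
  proof (induction u arbitrary: v rule: rev_induct)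
    case (snoc x u)
    show ?case
    proof (cases "v = [] \<or> hd v \<noteq> letter_inv x")
      case True
      then have "reduced ((u @ [x]) @ v)"
        using reduced_append_iff[of "u @ [x]" v] snoc.prems True by simp
      then have "u @ [x] = (u @ [x]) @ [] \<and> v = winv [] @ v \<and> reduced ((u @ [x]) @ v)"
        by simp
      then show ?thesis by blast
    next
      case False
      then obtain v' where v: "v = letter_inv x # v'" by (cases v) auto
      then have "reduced u" "reduced v'"
        using snoc.prems by (auto simp: reduced_append_iff reduced_Cons_iff)
      then obtain s p t where "u = s @ p" "v' = winv p @ t" "reduced (s @ t)"
        using snoc.IH by blast
      then have "u @ [x] = s @ (p @ [x]) \<and> v = winv (p @ [x]) @ t \<and> reduced (s @ t)"
        using v by (simp add: winv_def)
      then show ?thesis by blast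
    qed
  qed auto
  then show thesis using that by blast
qed

lemma red_cancel: "reduced (s @ t) \<Longrightarrow> red ((s @ p) @ winv p @ t) = s @ t"
  by (metis append_assoc red_append_cong red_append_winv red_reduced)

lemma reduced_append_winv: "reduced (p @ winv p) \<Longrightarrow> p = []"
  by (cases p rule: rev_cases) (auto simp: winv_def reduced_append_iff reduced_Cons_iff)

text \<open>The outer letters of such a word are inverse to each other and can be stripped, until
  two adjacent inverse letters or a letter equal to its own inverse would remain.\<close>

lemma reduced_eq_winv: "reduced r \<Longrightarrow> r = winv r \<Longrightarrow> r = []"
proof (induction "length r" arbitrary: r rule: less_induct)
  case less
  show ?case
  proof (cases r)
    case (Cons x r')
    show ?thesis
    proof (cases r' rule: rev_cases)
      case Nil
      then show ?thesis using less.prems Cons by (simp add: winv_def)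
    next
      case (snoc r'' y)
      have eq: "x # r'' @ [y] = winv (x # r'' @ [y])"
        using less.prems(2) unfolding Cons snoc .
      have *: "winv (x # r'' @ [y]) = letter_inv y # winv r'' @ [letter_inv x]"
        by (simp add: winv_def)
      have y: "y = letter_inv x" "r'' = winv r''"
        using eq unfolding * list.inject by (metis last_snoc, metis butlast_snoc)
      have "reduced r''"
        using less.prems(1) unfolding Cons snoc by (simp add: reduced_Cons_iff reduced_append_iff)
      moreover have "length r'' < length r"
        unfolding Cons snoc by simp
      ultimately have "r'' = []"
        using less.hyps y(2) by blast
      then show ?thesis
        using less.prems(1) y(1) unfolding Cons snoc by (simp add: reduced_Cons_iff)
    qed
  qed simp
qed

text \<open>Otherwise \<open>p\<close> and its inverse would overlap in \<open>g\<close> in a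
  nonempty word that is its own inverse.\<close>

lemma self_overlap:
  assumes "reduced g" "g = s @ p" "g = winv p @ t"
  shows "length p \<le> length s"
proof (rule ccontr)
  assume len: "\<not> length p \<le> length s"
  have "s @ p = winv p @ t" using assms by simp
  from arg_cong[OF this, of "take (length s)"] have "s = take (length s) (winv p)"
    using len by simp
  then obtain r where r: "winv p = s @ r" by (metis append_take_drop_id)
  then have "p = r @ t" using assms by simp
  moreover have "p = winv r @ winv s" using r by (metis winv_append winv_winv)
  ultimately have "r = winv r" by (metis append_eq_append_conv length_winv)
  moreover have "reduced r"
    using assms(1,3) r by (simp add: reduced_append_iff)
  ultimately have "r = []" by (rule reduced_eq_winv[rotated])
  then show False using r len by (metis append_Nil2 length_winv order_refl)
qed

text \<open>
  Nielsen's tie-break for cancellation of exactly one half: words of equal length are compared as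
  numerals in base \<open>2 n\<close>, and each basis element contributes the first half of itself and of its inverse.
\<close>

fun val :: "nat \<Rightarrow> word \<Rightarrow> nat" where
  "val n [] = 0"
| "val n (x # w) = (2 * fst x + of_bool (snd x)) * (2 * n) ^ length w + val n w"

lemma val_append: "val n (u @ v) = val n u * (2 * n) ^ length v + val n v"
  by (induction u) (auto simp: algebra_simps power_add)

lemma val_less: "set w \<subseteq> letters n \<Longrightarrow> val n w < (2 * n) ^ length w"
proof (induction w)
  case (Cons x w)
  have "2 * fst x + of_bool (snd x) + 1 \<le> 2 * n"
    using Cons.prems by (auto simp: letters_def of_bool_def)
  then have "(2 * fst x + of_bool (snd x) + 1) * (2 * n) ^ length w \<le> 2 * n * (2 * n) ^ length w"
    by (rule mult_right_mono) simp
  then show ?case using Cons by (simp add: algebra_simps)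
qed simp

lemma val_inj:
  assumes "length u = length v" "set u \<subseteq> letters n" "set v \<subseteq> letters n" "val n u = val n v"
  shows "u = v"
  using assms
proof (induction u v rule: list_induct2)
  case (Cons x u y v)
  define B where "B = (2 * n) ^ length v"
  have less: "val n u < B" "val n v < B"
    using val_less[of u n] val_less[of v n] Cons by (auto simp: B_def)
  have div: "(c * B + r) div B = c" "(c * B + r) mod B = r" if "r < B" for c r
    using that by simp_all
  have "val n (x # u) = (2 * fst x + of_bool (snd x)) * B + val n u"
    "val n (y # v) = (2 * fst y + of_bool (snd y)) * B + val n v"
    using Cons.hyps by (simp_all only: val.simps B_def)
  then have "2 * fst x + of_bool (snd x) = 2 * fst y + (of_bool (snd y) :: nat)" "val n u = val n v"
    using Cons.prems div[OF less(1)] div[OF less(2)] by metis+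
  then show ?case
    using Cons by (auto simp: of_bool_def prod_eq_iff split: if_splits) presburger+
qed simp

definition half_val :: "nat \<Rightarrow> word \<Rightarrow> nat" where
  "half_val n w = val n (take ((length w + 1) div 2) w)"

text \<open>An automorphism given by the images of the letters; bijectivity of the induced
  endomorphism expresses that these images form a free basis.\<close>

definition free_basis :: "nat \<Rightarrow> (letter \<Rightarrow> word) \<Rightarrow> bool" where
  "free_basis n f \<longleftrightarrow> respects_inv f \<and> (\<forall>x. reduced (f x)) \<and>
     (\<forall>x\<in>letters n. f x \<in> carrier (free_group n)) \<and>
     bij_betw (lift_hom f) (carrier (free_group n)) (carrier (free_group n))"

text \<open>The elementary Nielsen transformation. As \<open>x\<close> and \<open>a\<close> range
  over letters, it includes multiplication on the left and by inverses.\<close>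

definition nielsen :: "letter \<Rightarrow> letter \<Rightarrow> (letter \<Rightarrow> word) \<Rightarrow> letter \<Rightarrow> word" where
  "nielsen x a f = f (x := red (f x @ f a), letter_inv x := winv (red (f x @ f a)))"

definition nielsen_measure :: "nat \<Rightarrow> ((letter \<Rightarrow> word) \<times> (letter \<Rightarrow> word)) set" where
  "nielsen_measure n = measures [\<lambda>f. \<Sum>x\<in>letters n. length (f x), \<lambda>f. \<Sum>x\<in>letters n. half_val n (f x)]"

lemma whitehead_bij:
  assumes "separates A a" "a \<in> letters n"
  shows "bij_betw (whitehead A a) (carrier (free_group n)) (carrier (free_group n))"
proof (rule bij_betwI)
  let ?D = "insert (Some (letter_inv a)) (A - {Some a})"
  have "insert (Some a) (?D - {Some (letter_inv a)}) = A"
    using assms by (auto simp: separates_def)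
  then show "whitehead A a (whitehead ?D (letter_inv a) w) = w" if "w \<in> carrier (free_group n)" for w
    using whitehead_inverse[OF separates_inverse[OF assms(1)], of w] that
    by (simp add: carrier_free_group red_reduced)
  show "whitehead ?D (letter_inv a) (whitehead A a w) = w" if "w \<in> carrier (free_group n)" for w
    using whitehead_inverse[OF assms(1), of w] that by (simp add: carrier_free_group red_reduced)
  show "whitehead A a \<in> carrier (free_group n) \<rightarrow> carrier (free_group n)"
    "whitehead ?D (letter_inv a) \<in> carrier (free_group n) \<rightarrow> carrier (free_group n)"
    using whitehead_carrier assms(2) by auto
qed

text \<open>Links Nielsen's method to Whitehead steps: a Nielsen transformation precomposes with one
  Whitehead automorphism.\<close>

lemma lift_hom_nielsen:
  assumes "respects_inv f" "\<And>x. reduced (f x)" "x \<noteq> a" "x \<noteq> letter_inv a"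
  shows "lift_hom (nielsen x a f) w = lift_hom f (whitehead {Some a, Some x} a w)"
proof -
  have "red (nielsen x a f y) = red (concat (map f (whitehead_map {Some a, Some x} a y)))" for y
  proof -
    have "x \<noteq> letter_inv x" "letter_inv a \<noteq> a" by simp_all
    then show ?thesis
      using assms respects_invD[OF assms(1)]
      by (auto simp: nielsen_def whitehead_map_def transit_def letter_inv_swap red_reduced red_winv[symmetric])
  qed
  then show ?thesis
    unfolding lift_hom_lift_hom[OF assms(1)] by (intro lift_hom_cong) blast
qed

lemma free_basis_nielsen:
  assumes f: "free_basis n f" and xa: "x \<in> letters n" "a \<in> letters n" "x \<noteq> a" "x \<noteq> letter_inv a"
  shows "free_basis n (nielsen x a f)"
proof -
  have r: "respects_inv f" "\<And>x. reduced (f x)" using f by (auto simp: free_basis_def)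
  have s: "separates {Some a, Some x} a" using xa by (auto simp: separates_def)
  have "red (f x @ f a) \<in> carrier (free_group n)"
    using f xa set_red[of "f x @ f a"] by (force simp: free_basis_def carrier_free_group)
  then have "\<forall>y\<in>letters n. nielsen x a f y \<in> carrier (free_group n)"
    using f by (force simp: nielsen_def free_basis_def carrier_free_group)
  moreover have "respects_inv (nielsen x a f)"
    using respects_invD[OF r(1)] unfolding respects_inv_def nielsen_def
      by (auto simp: letter_inv_swap)
  moreover have "bij_betw (lift_hom (nielsen x a f)) (carrier (free_group n)) (carrier (free_group n))"
  proof -
    have "lift_hom (nielsen x a f) = lift_hom f \<circ> whitehead {Some a, Some x} a"
      using lift_hom_nielsen[OF r xa(3,4)] by auto
    then show ?thesis
      using bij_betw_trans[OF whitehead_bij[OF s xa(2)], of "lift_hom f"] f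
      by (simp add: free_basis_def del: split_paired_All)
  qed
  ultimately show ?thesis
    using r(2) by (simp add: free_basis_def nielsen_def)
qed

lemma nielsen_apply:
  "nielsen x a f x = red (f x @ f a)" "nielsen x a f (letter_inv x) = winv (red (f x @ f a))"
  by (simp_all add: nielsen_def)

lemma sum_nielsen:
  fixes g :: "word \<Rightarrow> nat"
  assumes "x \<in> letters n"
  shows "(\<Sum>y\<in>letters n. g (nielsen x a f y)) + (g (f x) + g (f (letter_inv x))) =
    (\<Sum>y\<in>letters n. g (f y)) + (g (red (f x @ f a)) + g (winv (red (f x @ f a))))"
proof -
  let ?S = "letters n - {x} - {letter_inv x}"
  have split: "sum h (letters n) = h x + (h (letter_inv x) + sum h ?S)" for h :: "letter \<Rightarrow> nat"
    using assms sum.remove[of "letters n" x h] sum.remove[of "letters n - {x}" "letter_inv x" h] by simp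
  have "(\<Sum>y\<in>?S. g (nielsen x a f y)) = (\<Sum>y\<in>?S. g (f y))"
    by (rule sum.cong) (auto simp: nielsen_def)
  moreover have "(\<Sum>y\<in>letters n. g (nielsen x a f y)) =
      g (red (f x @ f a)) + (g (winv (red (f x @ f a))) + (\<Sum>y\<in>?S. g (nielsen x a f y)))"
    using split[of "\<lambda>y. g (nielsen x a f y)"] by (simp only: nielsen_apply)
  ultimately show ?thesis
    using split[of "\<lambda>y. g (f y)"] by linarith
qed

section \<open>Bases that no Nielsen transformation improves\<close>

locale nielsen_minimal =
  fixes n :: nat and f :: "letter \<Rightarrow> word"
  assumes basis: "free_basis n f"
    and minimal: "\<lbrakk>x \<in> letters n; a \<in> letters n; x \<noteq> a; x \<noteq> letter_inv a\<rbrakk> \<Longrightarrow>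
      (nielsen x a f, f) \<notin> nielsen_measure n"
begin

lemma f_inv: "f (letter_inv x) = winv (f x)"
  using basis by (auto simp: free_basis_def intro: respects_invD)

lemma reduced_f: "reduced (f x)"
  using basis unfolding free_basis_def by blast

lemma set_f: "x \<in> letters n \<Longrightarrow> set (f x) \<subseteq> letters n"
  using basis by (auto simp: free_basis_def carrier_free_group)

lemma f_neq_Nil:
  assumes "x \<in> letters n"
  shows "f x \<noteq> []"
proof
  assume "f x = []"
  then have "lift_hom f [x] = lift_hom f []" by (simp add: lift_hom_def)
  moreover have "[x] \<in> carrier (free_group n)" "[] \<in> carrier (free_group n)"
    using assms by (simp_all add: carrier_free_group)
  moreover have "inj_on (lift_hom f) (carrier (free_group n))"
    using basis by (simp add: free_basis_def bij_betw_def)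
  ultimately show False by (metis inj_onD not_Cons_self)
qed

lemma not_shorter:
  assumes "x \<in> letters n" "a \<in> letters n" "x \<noteq> a" "x \<noteq> letter_inv a"
  shows "length (f x) \<le> length (red (f x @ f a))"
    and "length (f x) = length (red (f x @ f a)) \<Longrightarrow>
      half_val n (f x) + half_val n (f (letter_inv x)) \<le>
      half_val n (red (f x @ f a)) + half_val n (winv (red (f x @ f a)))"
proof -
  have *: "\<not> (\<Sum>y\<in>letters n. length (nielsen x a f y)) < (\<Sum>y\<in>letters n. length (f y))"
    "(\<Sum>y\<in>letters n. length (nielsen x a f y)) = (\<Sum>y\<in>letters n. length (f y)) \<Longrightarrow>
      \<not> (\<Sum>y\<in>letters n. half_val n (nielsen x a f y)) < (\<Sum>y\<in>letters n. half_val n (f y))"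
    using minimal[OF assms] by (auto simp: nielsen_measure_def)
  have len: "length (f (letter_inv x)) = length (f x)" by (simp add: f_inv)
  show "length (f x) \<le> length (red (f x @ f a))"
    using sum_nielsen[OF assms(1), of length a f] *(1) len by simp
  show "half_val n (f x) + half_val n (f (letter_inv x)) \<le>
      half_val n (red (f x @ f a)) + half_val n (winv (red (f x @ f a)))"
    if "length (f x) = length (red (f x @ f a))"
    using sum_nielsen[OF assms(1), of length a f] sum_nielsen[OF assms(1), of "half_val n" a f] *(2) len that
    by simp
qed

text \<open>Cancelling more than half of either factor would let a Nielsen transformation of
  \<open>x\<close>, or of the inverse of \<open>a\<close>, shorten the basis; for
  \<open>x = a\<close> the bound comes from \<open>self_overlap\<close>.\<close>

lemma overlap_le:
  assumes "x \<in> letters n" "a \<in> letters n" "x \<noteq> letter_inv a"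
    and "f x = s @ p" "f a = winv p @ t" "reduced (s @ t)"
  shows "length p \<le> length t" "length p \<le> length s"
proof -
  have "length p \<le> length t \<and> length p \<le> length s"
  proof (cases "x = a")
    case True
    then show ?thesis
      using self_overlap[OF reduced_f[of x], of s p t] assms
      by (metis add_le_cancel_left add.commute length_append length_winv nat_add_left_cancel_le)
  next
    case False
    have "letter_inv a \<noteq> letter_inv x" "letter_inv a \<noteq> letter_inv (letter_inv x)"
      using assms(3) False by auto
    then have "length (f (letter_inv a)) \<le> length (red (f (letter_inv a) @ f (letter_inv x)))"
      using not_shorter(1)[of "letter_inv a" "letter_inv x"] assms(1,2) by simp
    also have "red (f (letter_inv a) @ f (letter_inv x)) = winv (red (f x @ f a))"
      by (simp add: f_inv red_winv[symmetric])
    finally show ?thesis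
      using not_shorter(1)[OF assms(1,2) False assms(3)] red_cancel[OF assms(6), of p] assms(4,5)
      by (simp add: f_inv)
  qed
  then show "length p \<le> length t" "length p \<le> length s" by auto
qed

text \<open>Multiplying \<open>f z\<close> by \<open>f y\<close> on the left replaces its prefix
  \<open>q\<close> by the equally long \<open>p\<close>. The total length stays the same, so
  minimality compares the halves.\<close>

lemma half_overlap:
  assumes "y \<in> letters n" "z \<in> letters n" "z \<noteq> y" "z \<noteq> letter_inv y"
    and "f y = p @ winv q" "f z = q @ t" "length p = length q" "length q \<le> length t" "reduced (p @ t)"
  shows "val n q \<le> val n p"
proof -
  have eq: "red (f (letter_inv z) @ f (letter_inv y)) = winv (p @ t)"
  proof -
    have "red (f y @ f z) = p @ t"
      using red_cancel[OF assms(9), of "winv q"] assms(5,6) by simp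
    then have "red (winv (f y @ f z)) = winv (p @ t)"
      by (simp only: red_winv)
    then show ?thesis by (simp add: f_inv)
  qed
  have "letter_inv z \<noteq> letter_inv y" "letter_inv z \<noteq> letter_inv (letter_inv y)"
    using assms(3,4) by auto
  then have "half_val n (f (letter_inv z)) + half_val n (f (letter_inv (letter_inv z))) \<le>
      half_val n (winv (p @ t)) + half_val n (winv (winv (p @ t)))"
    using not_shorter(2)[of "letter_inv z" "letter_inv y", unfolded eq] assms(1,2,6,7)
    by (simp add: f_inv)
  then have *: "half_val n (winv (q @ t)) + half_val n (q @ t) \<le> half_val n (winv (p @ t)) + half_val n (p @ t)"
    by (simp only: f_inv assms(6) winv_winv)
  \<comment> \<open>The half of \<open>q @ t\<close> contains all of \<open>q\<close>, while the
    half of its inverse stays inside the inverse of \<open>t\<close>.\<close>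
  have half: "(length q + length t + 1) div 2 \<le> length t" "length q \<le> (length q + length t + 1) div 2"
    using assms(8) f_neq_Nil[OF assms(1)] assms(5,7) by auto
  have "half_val n (winv (q @ t)) = half_val n (winv (p @ t))"
    using half assms(7) by (simp add: half_val_def add.commute)
  then have "half_val n (q @ t) \<le> half_val n (p @ t)"
    using * by simp
  \<comment> \<open>Behind \<open>q\<close> and \<open>p\<close> both halves continue with the same
    prefix of \<open>t\<close>, so the leading digits decide.\<close>
  then have "val n q * (2 * n) ^ k + r \<le> val n p * (2 * n) ^ k + r"
    if "k = (length q + length t + 1) div 2 - length q" "r = val n (take k t)" for k r
    using half that assms(7) by (simp add: half_val_def val_append)
  then have "val n q * (2 * n) ^ ((length q + length t + 1) div 2 - length q) \<le>
      val n p * (2 * n) ^ ((length q + length t + 1) div 2 - length q)" by simp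
  moreover have "n > 0" using assms(1) by (auto simp: letters_def)
  ultimately show ?thesis by simp
qed

text \<open>Otherwise both cancellations take exactly half of \<open>f y\<close>. The tie-break from
  the two sides then gives the two halves \<open>p\<close> and \<open>q\<close> equal values, so
  \<open>p = q\<close>, and \<open>f y = p @ winv q\<close> would not be reduced.\<close>

lemma overlaps_less:
  assumes xyz: "x \<in> letters n" "y \<in> letters n" "z \<in> letters n" "y \<noteq> letter_inv x" "z \<noteq> letter_inv y"
    and xy: "f x = s1 @ p1" "f y = winv p1 @ t1" "reduced (s1 @ t1)"
    and yz: "f y = s2 @ p2" "f z = winv p2 @ t2" "reduced (s2 @ t2)"
  shows "length p1 + length p2 < length (f y)"
proof (rule ccontr)
  assume neg: "\<not> length p1 + length p2 < length (f y)"
  have "x \<noteq> letter_inv y" "y \<noteq> letter_inv z" using xyz by auto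
  note o1 = overlap_le[OF xyz(1,2) this(1) xy] and o2 = overlap_le[OF xyz(2,3) this(2) yz]
  have len: "length p1 = length t1" "length p2 = length s2" "length p1 = length p2"
    using neg o1 o2 arg_cong[OF xy(2), of length] arg_cong[OF yz(1), of length] by simp_all
  have "winv p1 @ t1 = s2 @ p2" using xy(2) yz(1) by simp
  then have st: "s2 = winv p1" "t1 = p2"
    using len by (simp_all add: append_eq_append_conv)
  define p q where "p = winv p1" and "q = winv p2"
  have fy: "f y = p @ winv q" using yz(1) st by (simp add: p_def q_def)
  have fx: "f x = s1 @ winv p" using xy(1) by (simp add: p_def)
  have fz: "f z = q @ t2" using yz(2) by (simp add: q_def)
  have lpq: "length p = length q" using len by (simp add: p_def q_def)
  have "p \<noteq> q"
    using reduced_append_winv[of p] reduced_f[of y] f_neq_Nil[OF xyz(2)] fy by auto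
  have "z \<noteq> y"
    using fy fz lpq \<open>p \<noteq> q\<close> by auto
  then have "val n q \<le> val n p"
    using half_overlap[OF xyz(2,3) _ xyz(5) fy fz lpq] o2 yz(3) st lpq
    by (simp add: q_def p_def)
  moreover have "val n p \<le> val n q"
  proof -
    have "x \<noteq> y"
      using fy fx lpq \<open>p \<noteq> q\<close> by auto
    \<comment> \<open>The same comparison for the inverses of \<open>y\<close> and \<open>x\<close>,
      where \<open>p\<close> and \<open>q\<close> change roles.\<close>
    then have ne: "letter_inv x \<noteq> letter_inv y" "letter_inv x \<noteq> letter_inv (letter_inv y)"
      using xyz(4) by auto
    have "reduced (winv (s1 @ winv q))"
      using xy(3) st by (simp only: reduced_winv) (simp add: q_def)
    then show ?thesis
      using half_overlap[OF _ _ ne, of q p "winv s1"] xyz o1 len lpq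
      by (simp add: f_inv fy fx p_def)
  qed
  ultimately have "val n p = val n q" by simp
  moreover have "set p \<subseteq> letters n" "set q \<subseteq> letters n"
    using set_f[OF xyz(2)] fy set_winv[of q] by (auto simp: image_subset_iff)
  ultimately show False
    using val_inj[OF lpq] \<open>p \<noteq> q\<close> by blast
qed

text \<open>Here \<open>a\<close> is the part of \<open>f x\<close> that survives cancellation with
  the next factor, and \<open>v\<close> contains at least one surviving letter for each later
  factor.\<close>

lemma lift_hom_prefix:
  assumes "reduced (x # w)" "set (x # w) \<subseteq> letters n"
  shows "\<exists>a b v. f x = a @ b \<and> lift_hom f (x # w) = a @ v \<and> length w \<le> length v \<and>
     (case w of [] \<Rightarrow> b = [] | y # _ \<Rightarrow> \<exists>t. f y = winv b @ t \<and> reduced (a @ t))"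
  using assms
proof (induction w arbitrary: x)
  case Nil
  have "lift_hom f [x] = f x" using reduced_f by (simp add: lift_hom_def red_reduced)
  then show ?case by auto
next
  case (Cons y w)
  have xy: "x \<in> letters n" "y \<in> letters n" "x \<noteq> letter_inv y"
    using Cons.prems by (auto simp: reduced_Cons_iff)
  obtain s p t where sp: "f x = s @ p" "f y = winv p @ t" "reduced (s @ t)"
    using cancel_decomp[OF reduced_f reduced_f] .
  have "reduced (y # w)" "set (y # w) \<subseteq> letters n"
    using Cons.prems by (auto simp: reduced_Cons_iff)
  from Cons.IH[OF this] obtain a b v where IH: "f y = a @ b" "lift_hom f (y # w) = a @ v" "length w \<le> length v"
    "case w of [] \<Rightarrow> b = [] | y # _ \<Rightarrow> \<exists>t. f y = winv b @ t \<and> reduced (a @ t)" by blast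
  \<comment> \<open>Cancellation with \<open>f x\<close> does not use up the part \<open>a\<close>
    of \<open>f y\<close>, so a nonempty \<open>c\<close> remains and shields
    \<open>v\<close>.\<close>
  have len: "length p < length a"
  proof (cases w)
    case Nil
    then have "f y = a" using IH by simp
    then show ?thesis
      using overlap_le[OF xy sp] sp(2) f_neq_Nil[OF xy(2)] by (cases t) auto
  next
    case (Cons z w')
    then obtain t' where t': "f z = winv b @ t'" "reduced (a @ t')" using IH by auto
    have "z \<in> letters n" "z \<noteq> letter_inv y" "y \<noteq> letter_inv x"
      using Cons \<open>reduced (y # w)\<close> Cons.prems Cons xy by (auto simp: reduced_Cons_iff)
    then have "length p + length b < length (f y)"
      using overlaps_less[OF xy(1,2) _ _ _ sp IH(1) t'] by blast
    then show ?thesis using IH(1) by simp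
  qed
  have "winv p @ t = a @ b" using sp IH by simp
  from arg_cong[OF this, of "take (length p)"] have "winv p = take (length p) a"
    using len by simp
  then obtain c where "a = winv p @ c" by (metis append_take_drop_id)
  with \<open>winv p @ t = a @ b\<close> len have c: "a = winv p @ c" "t = c @ b" "c \<noteq> []"
    by auto
  have "lift_hom f (x # y # w) = red (f x @ lift_hom f (y # w))"
    by (simp add: lift_hom_def)
  also have "\<dots> = red (s @ c @ v)"
    unfolding IH(2) sp(1) c(1) append_assoc
    using red_append_cong[OF refl red_append_winv[of p "c @ v"], of s] by simp
  also have "\<dots> = s @ c @ v"
  proof (rule red_reduced)
    have "reduced (c @ v)"
      using reduced_lift_hom[of f "y # w"] unfolding IH(2) c(1) by (simp add: reduced_append_iff)
    then show "reduced (s @ c @ v)"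
      using sp(3) c(2,3) by (auto simp: reduced_append_iff)
  qed
  finally have "lift_hom f (x # y # w) = s @ (c @ v)" .
  moreover have "length (y # w) \<le> length (c @ v)"
    using c(3) IH(3) by (cases c) auto
  ultimately show ?case
    by (intro exI[of _ s] exI[of _ p] exI[of _ "c @ v"]) (use sp in auto)
qed

lemma length_lift_hom_ge:
  assumes "w \<in> carrier (free_group n)"
  shows "length w \<le> length (lift_hom f w)"
proof (cases w)
  case (Cons x w')
  then have xw: "reduced (x # w')" "set (x # w') \<subseteq> letters n" "x \<in> letters n"
    using assms by (auto simp: carrier_free_group)
  from lift_hom_prefix[OF this(1,2)] obtain a b v where
    *: "f x = a @ b" "lift_hom f (x # w') = a @ v" "length w' \<le> length v"
     "case w' of [] \<Rightarrow> b = [] | y # _ \<Rightarrow> \<exists>t. f y = winv b @ t \<and> reduced (a @ t)" by blast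
  have "a \<noteq> []"
  proof (cases w')
    case Nil
    then show ?thesis using * f_neq_Nil[OF xw(3)] by auto
  next
    case (Cons y w'')
    then obtain t where "f y = winv b @ t" "reduced (a @ t)" using * by auto
    moreover have "y \<in> letters n" "x \<noteq> letter_inv y"
      using xw Cons by (auto simp: reduced_Cons_iff)
    ultimately have "length b \<le> length a"
      using overlap_le(2)[OF xw(3) _ _ *(1)] by blast
    then show ?thesis using * f_neq_Nil[OF xw(3)] by auto
  qed
  then show ?thesis
    using * Cons by (cases a) auto
qed simp

text \<open>As the map never shortens a word, the preimage of a single letter is a single letter. So
  \<open>f\<close> hits all one-letter words, and counting makes it a bijection between
  letters.\<close>

lemma lift_hom_eq_map:
  obtains \<rho> where "signed_perm n \<rho>" "\<And>w. w \<in> carrier (free_group n) \<Longrightarrow> lift_hom f w = map \<rho> w"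
proof -
  have hit: "\<exists>x\<in>letters n. f x = [t]" if t: "t \<in> letters n" for t
  proof -
    have "[t] \<in> carrier (free_group n)" using t by (simp add: carrier_free_group)
    then obtain w where w: "w \<in> carrier (free_group n)" "lift_hom f w = [t]"
      using basis unfolding free_basis_def bij_betw_def by (metis imageE)
    then have "length w \<le> 1" using length_lift_hom_ge[OF w(1)] by simp
    moreover have "w \<noteq> []" using w by (auto simp: lift_hom_def)
    ultimately obtain x where x: "w = [x]" by (cases w) auto
    then have "f x = [t]" using w reduced_f by (simp add: lift_hom_def red_reduced)
    then show ?thesis using x w by (auto simp: carrier_free_group)
  qed
  let ?S = "(\<lambda>t. [t]) ` letters n"
  have sub: "?S \<subseteq> f ` letters n" 
  proof (rule image_subsetI)
    fix t assume "t \<in> letters n"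
    then obtain x where "x \<in> letters n" "f x = [t]" using hit by blast
    then show "[t] \<in> f ` letters n" by (intro image_eqI[of _ f x]) simp_all
  qed
  have cardS: "card ?S = card (letters n)" by (simp add: card_image inj_on_def)
  have img: "?S = f ` letters n"
    using card_seteq[OF _ sub] card_image_le[OF finite_letters, of f n] cardS by simp
  then have inj: "inj_on f (letters n)"
    using cardS by (intro eq_card_imp_inj_on) auto
  define \<rho> where "\<rho> x = (if x \<in> letters n then hd (f x) else x)" for x
  have f: "f x = [\<rho> x]" "\<rho> x \<in> letters n" if "x \<in> letters n" for x
  proof -
    from that img have "f x \<in> ?S" by blast
    then show "f x = [\<rho> x]" "\<rho> x \<in> letters n" using that by (auto simp: \<rho>_def)
  qed
  have "bij_betw \<rho> (letters n) (letters n)"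
  proof -
    have "inj_on \<rho> (letters n)"
      using inj f by (metis inj_on_def)
    moreover have "\<rho> ` letters n \<subseteq> letters n" using f(2) by blast
    ultimately show ?thesis
      unfolding bij_betw_def using endo_inj_surj[OF finite_letters] by blast
  qed
  then have "\<rho> permutes letters n"
    by (rule bij_imp_permutes) (simp add: \<rho>_def)
  moreover have "\<rho> (letter_inv x) = letter_inv (\<rho> x)" for x
  proof (cases "x \<in> letters n")
    case True
    then have "[\<rho> (letter_inv x)] = winv [\<rho> x]"
      using f[of x] f[of "letter_inv x"] f_inv[of x] by simp
    then show ?thesis by (simp add: winv_def)
  qed (simp add: \<rho>_def)
  ultimately have \<rho>: "signed_perm n \<rho>" unfolding signed_perm_def by blast
  have "lift_hom f w = map \<rho> w" if w: "w \<in> carrier (free_group n)" for w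
  proof -
    have "concat (map f w) = map \<rho> w"
      using w f by (induction w) (auto simp: carrier_free_group reduced_Cons_iff)
    then show ?thesis
      using map_red[OF \<rho>, of w] w by (simp add: lift_hom_def carrier_free_group red_reduced)
  qed
  with \<rho> show thesis by (rule that)
qed

end

text \<open>Induction on the Nielsen measure: a step leads from \<open>w\<close> to its preimage
  \<open>w'\<close> under a Whitehead automorphism, and the improved basis sends \<open>w'\<close>
  to the same word as \<open>f\<close> sends \<open>w\<close>. At a minimum a signed permutation
  remains.\<close>

lemma free_basis_conn:
  assumes "free_basis n f" "n > 0" "w \<in> carrier (free_group n)"
  shows "(whitehead_step n)\<^sup>*\<^sup>* w (lift_hom f w)"
proof -
  have "wf (nielsen_measure n)" by (simp add: nielsen_measure_def)
  then show ?thesis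
    using assms
  proof (induction f arbitrary: w rule: wf_induct_rule)
    case (less f)
    show ?case
    proof (cases "\<exists>x\<in>letters n. \<exists>a\<in>letters n. x \<noteq> a \<and> x \<noteq> letter_inv a \<and> (nielsen x a f, f) \<in> nielsen_measure n")
      case True
      then obtain x a where xa: "x \<in> letters n" "a \<in> letters n" "x \<noteq> a" "x \<noteq> letter_inv a"
        "(nielsen x a f, f) \<in> nielsen_measure n" by blast
      have f: "respects_inv f" "\<And>x. reduced (f x)"
        using less.prems by (auto simp: free_basis_def)
      have s: "separates {Some a, Some x} a" using xa by (auto simp: separates_def)
      obtain w' where w': "w' \<in> carrier (free_group n)" "w = whitehead {Some a, Some x} a w'"
        using whitehead_bij[OF s xa(2)] less.prems(3) unfolding bij_betw_def by (metis imageE)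
      have "whitehead_step n w' w"
        using whitehead_step_whitehead[OF s xa(2)] w'(2) by simp
      then have "whitehead_step n w w'"
        using whitehead_step_sym w'(1) by (simp add: carrier_free_group)
      moreover have "(whitehead_step n)\<^sup>*\<^sup>* w' (lift_hom (nielsen x a f) w')"
        using less.IH[OF xa(5) free_basis_nielsen[OF less.prems(1) xa(1-4)] less.prems(2) w'(1)] .
      ultimately show ?thesis
        using lift_hom_nielsen[OF f xa(3,4), of w'] w'(2)
          by (simp add: converse_rtranclp_into_rtranclp)
    next
      case False
      interpret nielsen_minimal n f
        using False less.prems(1) by unfold_locales blast+
      obtain \<rho> where \<rho>: "signed_perm n \<rho>" "\<And>w. w \<in> carrier (free_group n) \<Longrightarrow> lift_hom f w = map \<rho> w"
        using lift_hom_eq_map by blast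
      have "(0, True) \<in> letters n" using less.prems(2) by (simp add: letters_def)
      then show ?thesis
        using whitehead_step_map[OF \<rho>(1), of w] \<rho>(2) less.prems(3)
          by (auto simp: carrier_free_group)
    qed
  qed
qed

section \<open>Automorphisms of the free group\<close>

lemma mult_free_group: "v \<in> carrier (free_group n) \<Longrightarrow> u \<otimes>\<^bsub>free_group n\<^esub> v = red (u @ v)"
  by (simp add: free_group_def foldr_cons_reduce_eq_red)

lemma one_free_group: "\<one>\<^bsub>free_group n\<^esub> = []"
  by (simp add: free_group_def)

lemma inv_free_group:
  assumes "u \<in> carrier (free_group n)"
  shows "inv\<^bsub>free_group n\<^esub> u = winv u"
proof (rule group.inv_equality[OF group_free_group])
  show "winv u \<otimes>\<^bsub>free_group n\<^esub> u = \<one>\<^bsub>free_group n\<^esub>"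
    using assms by (simp add: mult_free_group one_free_group)
  show "winv u \<in> carrier (free_group n)"
    using assms by (auto simp: carrier_free_group)
qed (rule assms)

lemma red_in_carrier: "set w \<subseteq> letters n \<Longrightarrow> red w \<in> carrier (free_group n)"
  using set_red[of w] by (auto simp: carrier_free_group)

lemma single_in_carrier [simp]: "[x] \<in> carrier (free_group n) \<longleftrightarrow> x \<in> letters n"
  by (simp add: carrier_free_group)

text \<open>Members of \<open>auto\<close> are extensional functions, hence the restriction.\<close>

lemma restrict_in_autoI:
  assumes "bij_betw h (carrier (free_group n)) (carrier (free_group n))"
    and "\<And>u v. u \<in> carrier (free_group n) \<Longrightarrow> v \<in> carrier (free_group n) \<Longrightarrow> h (red (u @ v)) = red (h u @ h v)"
  shows "restrict h (carrier (free_group n)) \<in> auto (free_group n)"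
proof -
  have h: "h u \<in> carrier (free_group n)" if "u \<in> carrier (free_group n)" for u
    using assms(1) that by (auto simp: bij_betw_def)
  have "red (u @ v) \<in> carrier (free_group n)"
    if "u \<in> carrier (free_group n)" "v \<in> carrier (free_group n)" for u v
    using that by (intro red_in_carrier) (auto simp: carrier_free_group)
  then show ?thesis
    using assms h bij_betw_cong[of "carrier (free_group n)" "restrict h (carrier (free_group n))" h]
    by (auto simp: auto_def hom_def Bij_def mult_free_group)
qed

lemma auto_compose:
  assumes "\<phi> \<in> auto (free_group n)" "\<psi> \<in> auto (free_group n)"
  shows "compose (carrier (free_group n)) \<psi> \<phi> \<in> auto (free_group n)"
  using assms group.hom_compose[OF group_free_group, of \<phi> n "free_group n" \<psi> "free_group n"]
  by (auto simp: auto_def compose_Bij)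

lemma auto_carrier:
  "\<phi> \<in> auto (free_group n) \<Longrightarrow> w \<in> carrier (free_group n) \<Longrightarrow> \<phi> w \<in> carrier (free_group n)"
  by (auto simp: auto_def hom_def)

text \<open>Letters outside \<open>letters n\<close> are fixed, because \<open>free_basis\<close>
  constrains \<open>f\<close> on all letters.\<close>

lemma auto_free_basis:
  assumes \<phi>: "\<phi> \<in> auto (free_group n)"
  defines "f \<equiv> (\<lambda>x. if x \<in> letters n then \<phi> [x] else [x])"
  shows "free_basis n f" "w \<in> carrier (free_group n) \<Longrightarrow> lift_hom f w = \<phi> w"
proof -
  let ?C = "carrier (free_group n)"
  have hom: "\<phi> (red (u @ v)) = red (\<phi> u @ \<phi> v)" if "u \<in> ?C" "v \<in> ?C" for u v
    using \<phi> that auto_carrier[OF \<phi> that(2)] hom_mult[of \<phi> "free_group n" "free_group n" u v]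
    by (simp add: auto_def mult_free_group)
  have C: "\<phi> w \<in> ?C" if "w \<in> ?C" for w
    using auto_carrier[OF \<phi> that] .
  have Nil: "\<phi> [] = []"
  proof -
    have "[] \<in> ?C" by (simp add: carrier_free_group)
    then have "\<phi> [] = red (\<phi> [] @ \<phi> [])" "reduced (\<phi> [])"
      using hom[of "[]" "[]"] C[of "[]"] by (simp_all add: carrier_free_group)
    then have "red (winv (\<phi> []) @ \<phi> []) = red (winv (\<phi> []) @ \<phi> [] @ \<phi> [])"
      by (metis red_append_red)
    then show ?thesis using \<open>reduced (\<phi> [])\<close> by (simp add: red_reduced)
  qed
  have r: "reduced (f x)" for x
    using C[of "[x]"] by (simp add: f_def carrier_free_group)
  have "f (letter_inv x) = winv (f x)" for x
  proof (cases "x \<in> letters n")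
    case True
    then have "red (f x @ f (letter_inv x)) = []"
      using hom[of "[x]" "[letter_inv x]"] Nil by (simp add: f_def)
    then have "red (winv (f x) @ f x @ f (letter_inv x)) = red (winv (f x))"
      by (metis append_Nil2 red_append_red)
    then show ?thesis using r by (simp add: red_reduced)
  qed (simp add: f_def winv_def)
  then have f: "respects_inv f" unfolding respects_inv_def by blast
  have lift: "lift_hom f w = \<phi> w" if "w \<in> ?C" for w
    using that
  proof (induction w)
    case (Cons x w)
    then have w: "w \<in> ?C" "x \<in> letters n"
      by (auto simp: carrier_free_group reduced_Cons_iff)
    have "lift_hom f (x # w) = red (f x @ lift_hom f w)"
      by (simp add: lift_hom_def)
    also have "\<dots> = \<phi> (red (x # w))"
      using Cons.IH[OF w(1)] hom[of "[x]" w] w by (simp add: f_def)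
    finally show ?case using Cons.prems by (simp add: carrier_free_group red_reduced)
  qed (simp add: Nil lift_hom_def)
  then show "w \<in> ?C \<Longrightarrow> lift_hom f w = \<phi> w" .
  have "bij_betw (lift_hom f) ?C ?C"
    using \<phi> bij_betw_cong[of ?C "lift_hom f" \<phi>] lift by (auto simp: auto_def Bij_def)
  moreover have "f x \<in> ?C" if "x \<in> letters n" for x
    using that C[of "[x]"] by (simp add: f_def)
  ultimately show "free_basis n f"
    using f r unfolding free_basis_def by blast
qed

lemma whitehead_in_auto:
  assumes "separates A a" "a \<in> letters n"
  shows "restrict (whitehead A a) (carrier (free_group n)) \<in> auto (free_group n)"
  using whitehead_bij[OF assms] by (intro restrict_in_autoI) (simp_all add: lift_hom_append)

lemma map_in_auto:
  assumes "signed_perm n \<rho>"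
  shows "restrict (map \<rho>) (carrier (free_group n)) \<in> auto (free_group n)"
proof (rule restrict_in_autoI)
  show "bij_betw (map \<rho>) (carrier (free_group n)) (carrier (free_group n))"
    using map_signed_perm_carrier[OF assms] map_signed_perm_carrier[OF signed_perm_inv[OF assms]]
    by (intro bij_betwI[of _ _ _ "map (perm_inv \<rho>)"]) (auto simp only: map_inv_signed_perm[OF assms] Pi_I)
qed (simp add: map_red[OF assms])

lemma map_elementary:
  assumes "signed_perm n \<rho>"
  shows "restrict (map \<rho>) (carrier (free_group n)) \<in> elementary_whitehead n"
proof -
  let ?C = "carrier (free_group n)"
  have sb: "signed_basis n = (\<lambda>x. [x]) ` letters n"
    unfolding signed_basis_def by blast
  have "restrict (map \<rho>) ?C ` signed_basis n = (\<lambda>x. [x]) ` \<rho> ` letters n"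
    unfolding sb image_image by (intro image_cong) simp_all
  then have "restrict (map \<rho>) ?C ` signed_basis n = signed_basis n"
    by (simp add: sb permutes_image[OF signed_permD(1)[OF assms]])
  moreover have "inj_on (restrict (map \<rho>) ?C) (signed_basis n)"
    unfolding sb
      by (intro inj_onI) (auto simp: inj_eq[OF signed_permD(3)[OF assms]] simp del: split_paired_All)
  ultimately have "bij_betw (restrict (map \<rho>) ?C) (signed_basis n) (signed_basis n)"
    by (simp add: bij_betw_def)
  then show ?thesis
    using map_in_auto[OF assms] by (simp add: elementary_whitehead_def permutation_automorphism_def)
qed

text \<open>For sets without the marker the four memberships of \<open>x\<close> and its inverse
  give the four allowed images; the other sets are replaced by their complements.\<close>

lemma whitehead_elementary:
  assumes "separates A a" "a \<in> letters n"
  shows "restrict (whitehead A a) (carrier (free_group n)) \<in> elementary_whitehead n"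
proof -
  have main: "restrict (whitehead A a) (carrier (free_group n)) \<in> elementary_whitehead n"
    if A: "separates A a" "a \<in> letters n" "None \<notin> A" for A a
  proof -
    let ?\<phi> = "restrict (whitehead A a) (carrier (free_group n))"
    have single: "?\<phi> [x] = red (whitehead_map A a x)" if "x \<in> letters n" for x
      using that by (simp add: lift_hom_def)
    have a: "[a] \<in> signed_basis n" "?\<phi> [a] = [a]"
      using A single[of a]
        by (auto simp only: signed_basis_def) (simp add: whitehead_map_def red_reduced)
    have inva: "inv\<^bsub>free_group n\<^esub> [a] = [letter_inv a]"
      using A by (simp add: inv_free_group winv_def)
    have "?\<phi> u \<in> {u, u \<otimes>\<^bsub>free_group n\<^esub> [a], inv\<^bsub>free_group n\<^esub> [a] \<otimes>\<^bsub>free_group n\<^esub> u,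
        inv\<^bsub>free_group n\<^esub> [a] \<otimes>\<^bsub>free_group n\<^esub> u \<otimes>\<^bsub>free_group n\<^esub> [a]}"
      if u: "u \<in> basis n" "u \<noteq> [a]" "u \<noteq> inv\<^bsub>free_group n\<^esub> [a]" for u
    proof -
      obtain x where x: "u = [x]" "x \<in> letters n" "x \<noteq> a" "x \<noteq> letter_inv a"
        using u unfolding inva by (auto simp: basis_def letters_def)
      then have "?\<phi> u = red (transit A a None (Some (letter_inv x)) @ [x] @ transit A a (Some x) None)"
        using single by (simp add: whitehead_map_def)
      then show ?thesis
        using A x unfolding inva
        by (auto simp: transit_def mult_free_group red_reduced)
    qed
    then have "multiplier_automorphism n ?\<phi>"
      unfolding multiplier_automorphism_def using whitehead_in_auto[OF A(1,2)] a by blast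
    then show ?thesis by (simp add: elementary_whitehead_def)
  qed
  show ?thesis
  proof (cases "None \<in> A")
    case True
    then show ?thesis
      using main[of "- A" "letter_inv a"] assms by (simp add: separates_Compl whitehead_map_Compl)
  qed (use main assms in blast)
qed

section \<open>A finite set of generators closed under inverses\<close>

definition marked_letters :: "nat \<Rightarrow> letter option set" where
  "marked_letters n = insert None (Some ` letters n)"

text \<open>Bounding \<open>A\<close> by the marked letters makes the set finite; further members of
  \<open>A\<close> do not affect words of rank \<open>n\<close>.\<close>

definition generators :: "nat \<Rightarrow> (word \<Rightarrow> word) set" where
  "generators n = (\<lambda>\<rho>. restrict (map \<rho>) (carrier (free_group n))) ` {\<rho>. signed_perm n \<rho>} \<union>
     (\<lambda>(A, a). restrict (whitehead A a) (carrier (free_group n))) `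
       {(A, a). A \<subseteq> marked_letters n \<and> a \<in> letters n \<and> separates A a}"

lemma finite_generators: "finite (generators n)"
proof -
  have "{\<rho>. signed_perm n \<rho>} \<subseteq> {\<rho>. \<rho> permutes letters n}"
    by (auto simp: signed_perm_def)
  then have "finite {\<rho>. signed_perm n \<rho>}"
    using finite_permutations[OF finite_letters] by (rule finite_subset)
  moreover have "{(A, a). A \<subseteq> marked_letters n \<and> a \<in> letters n \<and> separates A a} \<subseteq> Pow (marked_letters n) \<times> letters n"
    by blast
  then have "finite {(A, a). A \<subseteq> marked_letters n \<and> a \<in> letters n \<and> separates A a}"
    by (rule finite_subset) (simp add: marked_letters_def)
  ultimately show ?thesis by (simp add: generators_def)
qed

lemma generators_elementary: "generators n \<subseteq> elementary_whitehead n"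
  by (auto simp: generators_def map_elementary whitehead_elementary)

lemma generators_auto: "\<tau> \<in> generators n \<Longrightarrow> \<tau> \<in> auto (free_group n)"
  by (auto simp: generators_def map_in_auto whitehead_in_auto)

lemma whitehead_Int:
  assumes "w \<in> carrier (free_group n)"
  shows "whitehead (A \<inter> marked_letters n) a w = whitehead A a w"
  using assms by (intro lift_hom_cong arg_cong[of _ _ red])
    (auto simp: whitehead_map_def transit_def marked_letters_def carrier_free_group)

lemma separates_Int: "separates A a \<Longrightarrow> a \<in> letters n \<Longrightarrow> separates (A \<inter> marked_letters n) a"
  by (auto simp: separates_def marked_letters_def)

lemma whitehead_in_generators:
  assumes "separates A a" "a \<in> letters n"
  shows "restrict (whitehead A a) (carrier (free_group n)) \<in> generators n"
proof -
  have "restrict (whitehead A a) (carrier (free_group n)) =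
      restrict (whitehead (A \<inter> marked_letters n) a) (carrier (free_group n))"
    using whitehead_Int by (auto simp: restrict_def fun_eq_iff)
  then show ?thesis
    using separates_Int[OF assms] assms
      by (auto simp: generators_def intro!: rev_image_eqI[of "(A \<inter> marked_letters n, a)"])
qed

text \<open>Lets the search walk back along every edge.\<close>

lemma generators_inverse:
  assumes "\<tau> \<in> generators n"
  shows "\<exists>\<tau>'\<in>generators n. \<forall>w\<in>carrier (free_group n). \<tau>' (\<tau> w) = w"
proof -
  let ?C = "carrier (free_group n)"
  consider \<rho> where "signed_perm n \<rho>" "\<tau> = restrict (map \<rho>) ?C"
    | A a where "separates A a" "a \<in> letters n" "\<tau> = restrict (whitehead A a) ?C"
    using assms by (auto simp: generators_def)
  then show ?thesis
  proof cases
    case 1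
    have "\<forall>w\<in>?C. restrict (map (perm_inv \<rho>)) ?C (\<tau> w) = w"
      using map_signed_perm_carrier[OF 1(1)] map_inv_signed_perm(2)[OF 1(1)]
      by (intro ballI) (simp add: 1(2) del: map_map)
    then show ?thesis
      using signed_perm_inv[OF 1(1)]
        by (auto simp: generators_def intro!: bexI[of _ "restrict (map (perm_inv \<rho>)) ?C"])
  next
    case 2
    let ?D = "insert (Some (letter_inv a)) (A - {Some a})"
    have "\<forall>w\<in>?C. restrict (whitehead ?D (letter_inv a)) ?C (\<tau> w) = w"
      using 2 whitehead_carrier[OF 2(2)]
        by (auto simp: whitehead_inverse carrier_free_group red_reduced)
    moreover have "restrict (whitehead ?D (letter_inv a)) ?C \<in> generators n"
      using 2 by (intro whitehead_in_generators separates_inverse) simp_all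
    ultimately show ?thesis by blast
  qed
qed

section \<open>Automorphic images as paths of constant length\<close>

definition level_step :: "nat \<Rightarrow> nat \<Rightarrow> word \<Rightarrow> word \<Rightarrow> bool" where
  "level_step n l x y \<longleftrightarrow> (\<exists>\<tau>\<in>generators n. y = \<tau> x) \<and> length y = l"

lemma automorphic_image_trans:
  assumes "automorphic_image n u v" "automorphic_image n v w" "u \<in> carrier (free_group n)"
  shows "automorphic_image n u w"
proof -
  obtain \<phi> \<psi> where "\<phi> \<in> auto (free_group n)" "\<psi> \<in> auto (free_group n)" "v = \<phi> u" "w = \<psi> v"
    using assms by (auto simp: automorphic_image_def)
  then show ?thesis
    using auto_compose[of \<phi> n \<psi>] assms(3)
    unfolding automorphic_image_def
      by (intro bexI[of _ "compose (carrier (free_group n)) \<psi> \<phi>"]) (auto simp: compose_def)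
qed

lemma automorphic_image_refl: "u \<in> carrier (free_group n) \<Longrightarrow> automorphic_image n u u"
  using group.id_in_auto[OF group_free_group, of n]
  by (auto simp: automorphic_image_def intro!: bexI[of _ "\<lambda>x\<in>carrier (free_group n). x"])

lemma automorphic_image_carrier:
  "automorphic_image n u v \<Longrightarrow> u \<in> carrier (free_group n) \<Longrightarrow> v \<in> carrier (free_group n)"
  by (auto simp: automorphic_image_def auto_carrier)

lemma level_steps_automorphic_image:
  assumes "(level_step n l)\<^sup>*\<^sup>* u v" "u \<in> carrier (free_group n)"
  shows "automorphic_image n u v"
  using assms(1)
proof (induction rule: rtranclp_induct)
  case (step v w)
  have "automorphic_image n v w"
    using step.hyps(2) by (auto simp: level_step_def automorphic_image_def intro: generators_auto)
  then show ?case using step.IH automorphic_image_trans assms(2) by blast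
qed (rule automorphic_image_refl[OF assms(2)])

text \<open>Peak reduction keeps the path at or below the length of \<open>u\<close>, and minimality
  of \<open>u\<close> keeps it from dropping. Each step is split into a Whitehead automorphism and a
  permutation, both of them generators.\<close>

lemma automorphic_image_level_steps:
  assumes u: "u \<in> carrier (free_group n)" "length_minimal n u" and "n > 0"
    and v: "automorphic_image n u v" "length v = length u"
  shows "(level_step n (length u))\<^sup>*\<^sup>* u v"
proof -
  let ?C = "carrier (free_group n)" and ?l = "length u"
  obtain \<phi> where \<phi>: "\<phi> \<in> auto (free_group n)" "v = \<phi> u"
    using v(1) by (auto simp: automorphic_image_def)
  have "(whitehead_step n)\<^sup>*\<^sup>* u v"
    using free_basis_conn[OF auto_free_basis(1)[OF \<phi>(1)] \<open>n > 0\<close> u(1)]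
    by (simp add: auto_free_basis(2)[OF \<phi>(1) u(1)] \<phi>(2))
  then have "level_conn n ?l u v"
    using level_conn_min u(1) v(2) by blast
  then have "(level_step n ?l)\<^sup>*\<^sup>* u v \<and> v \<in> ?C"
    unfolding level_conn_def
  proof (induction rule: rtranclp_induct)
    case (step x y)
    then obtain \<rho> A a where y: "signed_perm n \<rho>" "separates A a" "a \<in> letters n" "y = map \<rho> (whitehead A a x)"
      by (auto simp: whitehead_step_def)
    have steps: "(level_step n ?l)\<^sup>*\<^sup>* u x" and x: "x \<in> ?C" using step.IH by auto
    let ?z = "whitehead A a x"
    have z: "?z \<in> ?C" using whitehead_carrier[OF y(3) x] .
    have "automorphic_image n x ?z"
      using whitehead_in_auto[OF y(2,3)] x
        by (auto simp: automorphic_image_def intro!: bexI[of _ "restrict (whitehead A a) ?C"])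
    then have "automorphic_image n u ?z"
      using automorphic_image_trans level_steps_automorphic_image[OF steps u(1)] u(1) by blast
    then have "?l \<le> length ?z"
      using u(2) by (auto simp: length_minimal_def automorphic_image_def)
    moreover have "length ?z \<le> ?l" using step.hyps(2) y(4) by simp
    ultimately have lz: "length ?z = ?l" by simp
    have "level_step n ?l x ?z"
      using whitehead_in_generators[OF y(2,3)] x lz unfolding level_step_def
      by (intro conjI bexI[of _ "restrict (whitehead A a) ?C"]) auto
    moreover have "level_step n ?l ?z y"
      using y(1,4) z lz unfolding level_step_def
      by (intro conjI bexI[of _ "restrict (map \<rho>) ?C"]) (auto simp: generators_def)
    ultimately show ?case
      using steps map_signed_perm_carrier[OF y(1) z] y(4) by auto
  qed (use u(1) in simp)
  then show ?thesis by blast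
qed

lemma finite_same_length_images: "finite (same_length_images n u)"
proof (rule finite_subset)
  show "same_length_images n u \<subseteq> {w. set w \<subseteq> letters n \<and> length w = length u}"
    by (auto simp: same_length_images_def carrier_free_group)
qed (rule finite_lists_length_eq[OF finite_letters])

section \<open>Depth-first search\<close>

text \<open>
  The states are: arrival at a new word through edge \<open>q - 1\<close> or at the root (\<open>q \<le> K\<close>), trying edge \<open>i\<close>
  (\<open>K + 1 + i\<close>), walking back (\<open>2 K + 1\<close>), walking along the new edge \<open>i\<close> (\<open>2 K + 2 + i\<close>), and success.
  The mark of a word is \<open>r + 1\<close> if it was first reached through edge \<open>r\<close>, and \<open>0\<close> at the root; \<open>J r\<close> is an
  edge inverse to \<open>r\<close>.
\<close>

definition explorer :: "nat \<Rightarrow> (nat \<Rightarrow> word \<Rightarrow> word) \<Rightarrow> (nat \<Rightarrow> nat) \<Rightarrow> machine" where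
  "explorer K T J q m =
     (if q \<le> K then (q, Compare (3 * K + 2) (K + 1))
      else if q \<le> 2 * K then (m, Apply (T (q - K - 1)) (q + 1) (q + 1) (q + K + 1))
      else if q = 2 * K + 1 then (m, if m = 0 \<or> m > K then Halt False else Move (T (J (m - 1))) (K + 1 + m))
      else if q \<le> 3 * K + 1 then (m, Move (T (q - 2 * K - 2)) (q - 2 * K - 1))
      else (m, Halt True))"

lemma word_machine_explorer:
  assumes "\<And>i. i < K \<Longrightarrow> T i \<in> elementary_whitehead n" "\<And>i. i < K \<Longrightarrow> J i < K"
  shows "word_machine n (explorer K T J)"
  unfolding word_machine_def
proof (intro exI conjI allI impI)
  fix q m assume q: "q < 3 * K + 3" and m: "m < 3 * K + 3"
  show "fst (explorer K T J q m) < 3 * K + 3"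
    using q m by (simp add: explorer_def)
  consider "q \<le> K" | "K < q" "q \<le> 2 * K" | "q = 2 * K + 1" | "2 * K + 1 < q" "q \<le> 3 * K + 1" | "3 * K + 1 < q"
    by linarith
  then show "valid_action n (3 * K + 3) (snd (explorer K T J q m))"
  proof cases
    case 2
    then show ?thesis using assms(1)[of "q - K - 1"] by (simp add: explorer_def)
  next
    case 3
    then show ?thesis using assms(1)[of "J (m - 1)"] assms(2)[of "m - 1"]
      by (auto simp: explorer_def)
  next
    case 4
    then show ?thesis using assms(1)[of "q - 2 * K - 2"] by (simp add: explorer_def)
  qed (simp_all add: explorer_def)
qed simp

lemma explorer_simps:
  "j \<le> K \<Longrightarrow> explorer K T J j m = (j, Compare (3 * K + 2) (K + 1))"
  "i < K \<Longrightarrow> explorer K T J (K + 1 + i) m = (m, Apply (T i) (K + 1 + Suc i) (K + 1 + Suc i) (2 * K + 2 + i))"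
  "explorer K T J (K + 1 + K) 0 = (0, Halt False)"
  "r < K \<Longrightarrow> explorer K T J (K + 1 + K) (Suc r) = (Suc r, Move (T (J r)) (K + 1 + Suc r))"
  "i < K \<Longrightarrow> explorer K T J (2 * K + 2 + i) m = (m, Move (T i) (Suc i))"
  "explorer K T J (3 * K + 2) m = (m, Halt True)"
  by (auto simp: explorer_def)

section \<open>Correctness and running time of the search\<close>

locale exploration =
  fixes K :: nat and T :: "nat \<Rightarrow> word \<Rightarrow> word" and J :: "nat \<Rightarrow> nat"
    and C :: "word set" and u v :: word
  assumes closed: "i < K \<Longrightarrow> w \<in> C \<Longrightarrow> T i w \<in> C"
    and inverse: "i < K \<Longrightarrow> w \<in> C \<Longrightarrow> T (J i) (T i w) = w"
    and start: "u \<in> C"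
    and finite_reach: "finite {w. (\<lambda>x y. (\<exists>i<K. y = T i x) \<and> length y = length u)\<^sup>*\<^sup>* u w}"
begin

definition edge :: "word \<Rightarrow> word \<Rightarrow> bool" where
  "edge x y \<longleftrightarrow> (\<exists>i<K. y = T i x) \<and> length y = length u"

definition reach :: "word set" where
  "reach = {w. edge\<^sup>*\<^sup>* u w}"

lemma finite_reach' [simp]: "finite reach"
  using finite_reach unfolding reach_def edge_def .

lemma reach_carrier: "reach \<subseteq> C"
proof
  fix w assume "w \<in> reach"
  then have "edge\<^sup>*\<^sup>* u w" by (simp add: reach_def)
  then show "w \<in> C"
    by (induction rule: rtranclp_induct) (auto simp: edge_def start closed)
qed

lemma reach_step:
  "w \<in> reach \<Longrightarrow> i < K \<Longrightarrow> length (T i w) = length u \<Longrightarrow> T i w \<in> reach"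
  unfolding reach_def using rtranclp.rtrancl_into_rtrancl[of edge u w "T i w"]
    by (auto simp: edge_def)

abbreviation halts :: "config \<Rightarrow> nat \<Rightarrow> bool \<Rightarrow> bool" where
  "halts \<equiv> halts_from (explorer K T J) (length u) v"

text \<open>The stack belongs to the proof: the machine has only the marks, which record the same
  edges back to \<open>u\<close>.\<close>

fun return_path :: "(word \<rightharpoonup> nat) \<Rightarrow> word \<Rightarrow> (word \<times> nat) list \<Rightarrow> bool" where
  "return_path M w [] \<longleftrightarrow> w = u \<and> M w = Some 0"
| "return_path M w ((p, r) # S) \<longleftrightarrow> r < K \<and> M w = Some (Suc r) \<and> w = T r p \<and> return_path M p S"

definition scanned :: "(word \<rightharpoonup> nat) \<Rightarrow> nat \<Rightarrow> word \<Rightarrow> bool" where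
  "scanned M i w \<longleftrightarrow> (\<forall>j<i. length (T j w) = length u \<longrightarrow> T j w \<in> dom M)"

text \<open>\<open>i\<close> is the next edge to try at \<open>w\<close>. Words on the stack are
  scanned up to the edge through which they were left, all other obtained words completely.\<close>

definition search_inv :: "nat \<Rightarrow> word \<Rightarrow> (word \<rightharpoonup> nat) \<Rightarrow> (word \<times> nat) list \<Rightarrow> bool" where
  "search_inv i w M S \<longleftrightarrow> dom M \<subseteq> reach \<and> v \<notin> dom M \<and> return_path M w S \<and> i \<le> K \<and> scanned M i w \<and>
     (\<forall>(p, r)\<in>set S. scanned M (Suc r) p) \<and>
     (\<forall>x\<in>dom M. x = w \<or> x \<in> fst ` set S \<or> scanned M K x)"

text \<open>Each new word costs at most \<open>K\<close> trials, two moves and one comparison.\<close>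

definition remaining :: "nat \<Rightarrow> (word \<rightharpoonup> nat) \<Rightarrow> (word \<times> nat) list \<Rightarrow> nat" where
  "remaining i M S = (K + 3) * (card reach - card (dom M)) + (K - i) + (\<Sum>(p, r)\<leftarrow>S. K - r)"

lemma return_path_dom: "return_path M w S \<Longrightarrow> w \<in> dom M"
  by (cases S) auto

lemma return_path_upd:
  "return_path M w S \<Longrightarrow> x \<notin> dom M \<Longrightarrow> return_path (M(x \<mapsto> m)) w S"
  by (induction S arbitrary: w) (auto split: if_splits)

lemma scanned_upd: "scanned M i w \<Longrightarrow> scanned (M(x \<mapsto> m)) i w"
  by (auto simp: scanned_def)

lemma search_inv_reach: "search_inv i w M S \<Longrightarrow> w \<in> reach"
  using return_path_dom[of M w S] by (auto simp: search_inv_def)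

lemma search_inv_Suc:
  assumes "search_inv i w M S" "i < K" "length (T i w) = length u \<Longrightarrow> T i w \<in> dom M"
  shows "search_inv (Suc i) w M S"
proof -
  have "scanned M (Suc i) w"
    using assms by (auto simp: search_inv_def scanned_def less_Suc_eq)
  then show ?thesis using assms(1,2) by (simp add: search_inv_def)
qed

lemma search_inv_push:
  assumes "search_inv i w M S" "i < K" "T i w \<notin> dom M" "length (T i w) = length u" "T i w \<noteq> v"
  shows "search_inv 0 (T i w) (M(T i w \<mapsto> Suc i)) ((w, i) # S)"
proof -
  let ?M = "M(T i w \<mapsto> Suc i)"
  have w: "w \<in> reach" using assms(1) by (rule search_inv_reach)
  have w': "scanned ?M (Suc i) w"
    using assms(1) by (auto simp: search_inv_def scanned_def less_Suc_eq)
  have old: "x = w \<or> x \<in> fst ` set S \<or> scanned ?M K x" if "x \<in> dom M" for x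
    using assms(1) that scanned_upd unfolding search_inv_def by blast
  have stack: "scanned ?M (Suc r) p" if "(p, r) \<in> set S" for p r
    using assms(1) that scanned_upd[of M "Suc r" p] by (auto simp: search_inv_def)
  show ?thesis
    unfolding search_inv_def
  proof (intro conjI ballI)
    show "dom ?M \<subseteq> reach" "v \<notin> dom ?M"
      using assms(1,5) reach_step[OF w assms(2,4)] by (auto simp: search_inv_def)
    show "return_path ?M (T i w) ((w, i) # S)"
      using assms return_path_upd by (simp add: search_inv_def)
    show "scanned ?M 0 (T i w)" by (simp add: scanned_def)
    show "case z of (p, r) \<Rightarrow> scanned ?M (Suc r) p" if "z \<in> set ((w, i) # S)" for z
      using that w' stack by (cases z) auto
    show "x = T i w \<or> x \<in> fst ` set ((w, i) # S) \<or> scanned ?M K x"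
      if "x \<in> dom ?M" for x
    proof (cases "x = T i w")
      case False
      then have "x \<in> dom M" using that by (simp add: domIff)
      then show ?thesis using old[of x]
        by (simp only: list.set image_insert fst_conv insert_iff) blast
    qed simp
  qed simp
qed

lemma search_inv_pop:
  assumes "search_inv K w M ((p, r) # S)"
  shows "search_inv (Suc r) p M S"
  unfolding search_inv_def
proof (intro conjI ballI)
  have inv: "scanned M K w" "\<forall>x\<in>dom M. x = w \<or> x \<in> fst ` set ((p, r) # S) \<or> scanned M K x"
    using assms unfolding search_inv_def by (blast, blast)
  show "x = p \<or> x \<in> fst ` set S \<or> scanned M K x" if "x \<in> dom M" for x
    using bspec[OF inv(2) that] inv(1) by auto
qed (use assms in \<open>simp_all add: search_inv_def\<close>)

text \<open>With an empty stack every obtained word is fully scanned, so the obtained words contain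
  \<open>u\<close> and are closed under edges.\<close>

lemma search_inv_done:
  assumes "search_inv K w M []"
  shows "v \<notin> reach"
proof -
  have "x \<in> dom M" if "edge\<^sup>*\<^sup>* u x" for x
    using that
  proof (induction rule: rtranclp_induct)
    case base
    then show ?case using assms return_path_dom[of M w "[]"] by (auto simp: search_inv_def)
  next
    case (step x y)
    then show ?case using assms by (auto simp: search_inv_def edge_def scanned_def)
  qed
  then show ?thesis using assms by (auto simp: search_inv_def reach_def)
qed

text \<open>The 3 pays for trying the edge, walking along it and comparing; the unit of edge
  \<open>i\<close> itself stays on the stack for the walk back.\<close>

lemma remaining_push:
  assumes "search_inv i w M S" "i < K" "T i w \<notin> dom M" "length (T i w) = length u"
  shows "remaining 0 (M(T i w \<mapsto> m)) ((w, i) # S) + 3 = remaining i M S"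
proof -
  have w: "w \<in> reach" using assms(1) by (rule search_inv_reach)
  have sub: "insert (T i w) (dom M) \<subseteq> reach"
    using assms(1) reach_step[OF w assms(2,4)] by (simp add: search_inv_def)
  then have "finite (dom M)" using finite_subset[OF _ finite_reach'] by auto
  then have "card (dom M) < card reach"
    using card_mono[OF finite_reach' sub] assms(3) by simp
  then obtain d where "card reach = Suc (card (dom M) + d)"
    using less_imp_Suc_add by blast
  then show ?thesis
    using \<open>finite (dom M)\<close> assms(2,3) by (simp add: remaining_def)
qed

lemma continue_bound:
  assumes "transition (explorer K T J) (length u) v c = Continue c'"
    and "\<exists>t b. halts c' t b \<and> t \<le> k \<and> (b \<longleftrightarrow> Q)" "Suc k = k'"
  shows "\<exists>t b. halts c t b \<and> t \<le> k' \<and> (b \<longleftrightarrow> Q)"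
  using assms halts_from.continue by (metis Suc_le_mono)

lemma halts_scan:
  assumes "search_inv i w M S"
  shows "\<exists>t b. halts (K + 1 + i, w, M) t b \<and> t \<le> remaining i M S \<and> (b \<longleftrightarrow> v \<in> reach)"
  using assms
proof (induction "remaining i M S" arbitrary: i w M S rule: less_induct)
  case less
  have dom: "w \<in> dom M" and i: "i \<le> K"
    using less.prems return_path_dom by (auto simp: search_inv_def)
  then obtain m where m: "M w = Some m" by blast
  have same: "M(w \<mapsto> m) = M" using m by (simp add: fun_upd_idem)
  show ?case
  proof (cases "i < K")
    case True
    note apply_step = explorer_simps(2)[OF True, of T J m]
    show ?thesis
    proof (cases "length (T i w) = length u \<and> T i w \<notin> dom M")
      case False
      have "transition (explorer K T J) (length u) v (K + 1 + i, w, M) = Continue (K + 1 + Suc i, w, M)"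
        using False m same apply_step by (auto simp del: add_Suc_right)
      moreover have "search_inv (Suc i) w M S"
        using search_inv_Suc[OF less.prems True] False by blast
      moreover have "Suc (remaining (Suc i) M S) = remaining i M S"
        using True by (simp add: remaining_def)
      ultimately show ?thesis
        by (intro continue_bound[OF _ less.hyps]) simp_all
    next
      case new: True
      let ?w = "T i w"
      have ne: "?w \<noteq> w" using new dom by auto
      have t1: "transition (explorer K T J) (length u) v (K + 1 + i, w, M) = Continue (2 * K + 2 + i, w, M(?w \<mapsto> 0))"
        using new m same apply_step by simp
      have t2: "transition (explorer K T J) (length u) v (2 * K + 2 + i, w, M(?w \<mapsto> 0)) = Continue (Suc i, ?w, M(?w \<mapsto> 0))"
        using m explorer_simps(5)[OF True, of T J m] ne by (simp add: fun_upd_twist fun_upd_idem)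
      \<comment> \<open>The arrival state \<open>Suc i\<close> writes itself over the initial mark
        \<open>0\<close> and so records the edge to the new word.\<close>
      have t3: "transition (explorer K T J) (length u) v (Suc i, ?w, M(?w \<mapsto> 0)) =
          Continue (if ?w = v then 3 * K + 2 else K + 1, ?w, M(?w \<mapsto> Suc i))"
        using explorer_simps(1)[of "Suc i" K T J 0] True by simp
      have rem: "remaining 0 (M(?w \<mapsto> Suc i)) ((w, i) # S) + 3 = remaining i M S"
        using remaining_push[OF less.prems True] new by blast
      have chain: "\<exists>t b. halts (K + 1 + i, w, M) t b \<and> t \<le> remaining i M S \<and> (b \<longleftrightarrow> v \<in> reach)"
        if "halts (if ?w = v then 3 * K + 2 else K + 1, ?w, M(?w \<mapsto> Suc i)) t b"
          "t \<le> remaining 0 (M(?w \<mapsto> Suc i)) ((w, i) # S)" "b \<longleftrightarrow> v \<in> reach" for t b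
      proof (intro exI conjI)
        show "halts (K + 1 + i, w, M) (Suc (Suc (Suc t))) b"
          using t1 t2 t3 that(1) by (blast intro: halts_from.continue)
        show "Suc (Suc (Suc t)) \<le> remaining i M S" using that(2) rem by simp
      qed (rule that)
      show ?thesis
      proof (cases "?w = v")
        case True
        have "halts (3 * K + 2, ?w, M(?w \<mapsto> Suc i)) 0 True"
          by (rule halts_from.answer) (simp only: transition.simps explorer_simps prod.case perform.simps)
        moreover have "v \<in> reach"
          using reach_step[of w i] new True dom less.prems \<open>i < K\<close>
            by (auto simp: search_inv_def)
        ultimately show ?thesis
          using chain[of 0 True] True by simp
      next
        case False
        have "search_inv 0 ?w (M(?w \<mapsto> Suc i)) ((w, i) # S)"
          using search_inv_push[OF less.prems True] new False by blast
        moreover have "remaining 0 (M(?w \<mapsto> Suc i)) ((w, i) # S) < remaining i M S"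
          using rem by simp
        ultimately obtain t b where "halts (K + 1 + 0, ?w, M(?w \<mapsto> Suc i)) t b"
          "t \<le> remaining 0 (M(?w \<mapsto> Suc i)) ((w, i) # S)" "b \<longleftrightarrow> v \<in> reach"
          using less.hyps by blast
        then show ?thesis using chain False by simp
      qed
    qed
  next
    case False
    then have K: "i = K" using i by linarith
    show ?thesis
    proof (cases S)
      case Nil
      then have Mw: "M w = Some 0" and inv: "search_inv K w M []"
        using less.prems K by (auto simp: search_inv_def)
      have "halts (K + 1 + K, w, M) 0 False"
        by (rule halts_from.answer)
          (simp only: transition.simps Mw option.sel explorer_simps prod.case perform.simps)
      then show ?thesis using search_inv_done[OF inv] unfolding K by blast
    next
      case (Cons pr S')
      obtain p r where S: "S = (p, r) # S'" using Cons by (cases pr) auto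
      have *: "r < K" "M w = Some (Suc r)" "w = T r p" "return_path M p S'" "dom M \<subseteq> reach"
        using less.prems S by (auto simp: search_inv_def)
      have p: "p \<in> dom M" using return_path_dom[OF *(4)] .
      have same': "M(w \<mapsto> Suc r) = M" using *(2) by (simp add: fun_upd_idem)
      have "T (J r) w = p"
        using inverse[OF *(1), of p] p *(3,5) reach_carrier by blast
      then have "transition (explorer K T J) (length u) v (K + 1 + K, w, M) = Continue (K + 1 + Suc r, p, M)"
        using p by (simp only: transition.simps *(2) option.sel explorer_simps(4)[OF *(1)] prod.case
            perform.simps same' if_True)
      moreover have "search_inv (Suc r) p M S'"
        using search_inv_pop less.prems S K by blast
      moreover have "Suc (remaining (Suc r) M S') = remaining i M S"
        using *(1) S K by (simp add: remaining_def)
      ultimately show ?thesis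
        unfolding K by (intro continue_bound[OF _ less.hyps]) (simp_all add: K)
    qed
  qed
qed

lemma explorer_answers:
  "\<exists>t b. answers_in (explorer K T J) u v t b \<and> t \<le> (K + 3) * card reach \<and> (b \<longleftrightarrow> edge\<^sup>*\<^sup>* u v)"
proof -
  have u: "u \<in> reach" by (simp add: reach_def)
  then have "card reach > 0" by (auto simp: card_gt_0_iff)
  then obtain d where d: "card reach = Suc d" using gr0_implies_Suc by blast
  have t: "transition (explorer K T J) (length u) v (0, u, [u \<mapsto> 0]) =
      Continue (if u = v then 3 * K + 2 else K + 1, u, [u \<mapsto> 0])"
    using explorer_simps(1)[of 0 K T J] by simp
  show ?thesis
  proof (cases "u = v")
    case True
    have "halts (3 * K + 2, u, [u \<mapsto> 0]) 0 True"
      by (rule halts_from.answer) (simp only: transition.simps explorer_simps prod.case perform.simps)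
    then have "halts (0, u, [u \<mapsto> 0]) 1 True"
      using t True halts_from.continue by fastforce
    then show ?thesis
      using True d unfolding answers_in_def by (intro exI[of _ 1] exI[of _ True]) simp
  next
    case False
    have "search_inv 0 u [u \<mapsto> 0] []"
      using u False by (auto simp: search_inv_def scanned_def)
    from halts_scan[OF this] obtain t b where tb: "halts (K + 1, u, [u \<mapsto> 0]) t b"
      "t \<le> remaining 0 [u \<mapsto> 0] []" "b \<longleftrightarrow> v \<in> reach" by auto
    have "halts (0, u, [u \<mapsto> 0]) (Suc t) b"
      using t False tb(1) halts_from.continue by fastforce
    \<comment> \<open>The share \<open>K + 3\<close> of the root covers its \<open>K\<close> trials
      and the initial comparison.\<close>
    moreover have "Suc t \<le> (K + 3) * card reach"
      using tb(2) d by (simp add: remaining_def)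
    ultimately show ?thesis
      using tb(3) unfolding answers_in_def reach_def by blast
  qed
qed

end

theorem proposition3p1:
  fixes n :: nat
  assumes "n \<ge> 2"
  shows "\<exists>(P :: machine) (C :: nat). word_machine n P \<and>
    (\<forall>u\<in>carrier (free_group n). length_minimal n u \<longrightarrow>
      (\<forall>v\<in>carrier (free_group n). length v = length u \<longrightarrow>
        (\<exists>t b. answers_in P u v t b \<and>
               t \<le> C * card (same_length_images n u) \<and>
               (b \<longleftrightarrow> automorphic_image n u v))))"
proof -
  let ?C = "carrier (free_group n)"
  \<comment> \<open>The edges depend on \<open>n\<close> alone, so one machine and one constant
    \<open>K + 3\<close> serve all \<open>u\<close> and \<open>v\<close>.\<close>
  obtain Ts where Ts: "set Ts = generators n"
    using finite_list[OF finite_generators] by blast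
  define K where "K = length Ts"
  define T where "T i = Ts ! i" for i
  have T: "T i \<in> generators n" if "i < K" for i
    using that unfolding Ts[symmetric] T_def K_def by (rule nth_mem)
  have gen: "\<tau> \<in> generators n \<longleftrightarrow> (\<exists>i<K. \<tau> = T i)" for \<tau>
    unfolding Ts[symmetric] T_def K_def in_set_conv_nth by blast
  have "\<exists>j<K. \<forall>w\<in>?C. T j (T i w) = w" if i: "i < K" for i
  proof -
    obtain \<tau>' where \<tau>': "\<tau>' \<in> generators n" "\<forall>w\<in>?C. \<tau>' (T i w) = w"
      using generators_inverse[OF T[OF i]] by blast
    then show ?thesis using gen[of \<tau>'] by auto
  qed
  then obtain J where J: "\<And>i. i < K \<Longrightarrow> J i < K" "\<And>i w. i < K \<Longrightarrow> w \<in> ?C \<Longrightarrow> T (J i) (T i w) = w"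
    by metis
  have step: "(\<lambda>x y. (\<exists>i<K. y = T i x) \<and> length y = l) = level_step n l" for l
  proof -
    have "generators n = T ` {..<K}" using gen by blast
    then show ?thesis unfolding level_step_def by (intro ext) auto
  qed
  have "\<exists>t b. answers_in (explorer K T J) u v t b \<and> t \<le> (K + 3) * card (same_length_images n u) \<and>
      (b \<longleftrightarrow> automorphic_image n u v)"
    if u: "u \<in> ?C" "length_minimal n u" and v: "length v = length u" for u v
  proof -
    \<comment> \<open>All words that the search can reach are counted by \<open>N\<close>; this
      gives both its finiteness and the time bound.\<close>
    have sub: "{w. (level_step n (length u))\<^sup>*\<^sup>* u w} \<subseteq> same_length_images n u"
    proof clarify
      fix w assume w: "(level_step n (length u))\<^sup>*\<^sup>* u w"
      then have "length w = length u"
        by (cases rule: rtranclp.cases) (auto simp: level_step_def)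
      then show "w \<in> same_length_images n u"
        using level_steps_automorphic_image[OF w u(1)] automorphic_image_carrier u(1)
        by (auto simp: same_length_images_def)
    qed
    interpret exploration K T J ?C u v
      using J(2) u(1) auto_carrier[OF generators_auto[OF T]] finite_subset[OF sub finite_same_length_images]
      by unfold_locales (simp_all only: step)
    have edge: "edge = level_step n (length u)"
      unfolding step[symmetric] edge_def by blast
    obtain t b where tb: "answers_in (explorer K T J) u v t b" "t \<le> (K + 3) * card reach"
      "b \<longleftrightarrow> edge\<^sup>*\<^sup>* u v"
      using explorer_answers by blast
    have "card reach \<le> card (same_length_images n u)"
      using card_mono[OF finite_same_length_images sub] by (simp add: reach_def edge)
    then have "t \<le> (K + 3) * card (same_length_images n u)"
      using tb(2) by (meson le_trans mult_le_mono2)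
    moreover have "edge\<^sup>*\<^sup>* u v \<longleftrightarrow> automorphic_image n u v"
      using level_steps_automorphic_image[of n "length u" u v]
        automorphic_image_level_steps[of u n v] u v assms by (auto simp: edge)
    ultimately show ?thesis
      using tb(1,3) by blast
  qed
  moreover have "word_machine n (explorer K T J)"
    using T generators_elementary J(1) by (intro word_machine_explorer) blast+
  ultimately show ?thesis by blast
qed

end
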